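(* Assume $\sigma e^{-a}>1$ and consider the regime $\ell\to\infty$, $m\to\infty$, $q\to0$, $\ell q\to a\in\,]0,\infty[$, $m/\ell\to\alpha$. Let $\theta\in\{\ell,K+1\}$ and let $\nu^\theta$ be the invariant probability measure of the Markov chain on $\mathcal E_K$ with kernel $p^\theta$. For every continuous non-decreasing function $f:[0,1]\to\mathbb R$ with $f(0)=0$, $$\lim\int_{\mathcal E_K}f\Big(\frac{z_0+\cdots+z_K}{m}\Big)\,d\nu^\theta(z)=f(\rho^*_0+\cdots+\rho^*_K).$$
   Context: Fix $\kappa\ge2$, $\sigma>1$, integers $K\ge0$, $\ell\ge K+2$, $m\ge2$, $q\in\,]0,1-1/\kappa[$, $p=\kappa q/(\kappa-1)$, and the lumped mutation matrix $M_H(b,c)=\sum_{k-l=c-b}\binom{\ell-b}{k}\binom{b}{l}(p(1-1/\kappa))^k(1-p(1-1/\kappa))^{\ell-b-k}(p/\kappa)^l(1-p/\kappa)^{b-l}$ (sum over $0\le k\le\ell-b$, $0\le l\le b$). For $\theta\in\{\ell,K+1\}$ define coefficients $N^\theta(b,c)$, $b\in\{0,\dots,K\}\cup\{\theta\}$, $c\in\{0,\dots,K\}$: $N^\theta(b,c)=M_H(b,c)$ if $b\le c$ and $b\le K$; for $\theta=\ell$: $N^\ell(b,c)=0$ if $c<b\le K$ and $N^\ell(\ell,c)=0$; for $\theta=K+1$: $N^{K+1}(b,c)=M_H(c+1,c)$ if $c<b\le K+1$. Let $\mathcal E_K=\{z\in\mathbb N^{K+1}:z_0+\cdots+z_K\le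 m\}$, $w_i$ the $i$-th unit vector, $s(z)=\sum_lz_l$, $D(z)=m((\sigma-1)z_0+m)$ and $W_j(z)=\sigma z_0N^\theta(0,j)+\sum_{l=1}^Kz_lN^\theta(l,j)+(m-s(z))N^\theta(\theta,j)$. Define a kernel $p$ by $p(z,z+w_i)=(m-s(z))W_i(z)/D(z)$, $p(z,z-w_i)=z_i\big((\sigma-1)z_0+m-\sum_{h=0}^KW_h(z)\big)/D(z)$, $p(z,z-w_i+w_j)=z_iW_j(z)/D(z)$ for $i\ne j$ (whenever the target lies in $\mathcal E_K$), other off-diagonal entries $0$, diagonal completing rows to $1$. The kernel $p^\theta$ is obtained from $p$ by: from any $z$ with $z_0=0$, jump with probability $1$ to $z^\theta$, where $z^\ell=(1,0,\dots,0)$ and $z^{K+1}=(1,m-1,0,\dots,0)$ (with $z^{K+1}=(1)$ if $K=0$); from $z$ with $z_0=1$, $p^\theta(z,0)=p(z,z-w_0)+\sum_{i=1}^Kp(z,z-w_0+w_i)$ and $p^\theta(z,z')=0$ for all other $z'$ with $z'_0=0$; otherwise $p^\theta=p$. Let $\rho^*_k=(\sigma e^{-a}-1)\frac{a^k}{k!}\sum_{i\ge1}i^k\sigma^{-i}$. *)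

theory Defs
  imports "HOL-Analysis.Analysis"
begin

text \<open>Parameters: kap = kappa (alphabet size), sig = sigma, K, l = ell, m, q.
  Population vectors z in N^(K+1) are represented as functions nat => nat
  vanishing above K.\<close>

definition pmut :: "nat \<Rightarrow> real \<Rightarrow> real" where
  "pmut kap q = real kap * q / (real kap - 1)"

definition MH :: "nat \<Rightarrow> nat \<Rightarrow> real \<Rightarrow> nat \<Rightarrow> nat \<Rightarrow> real" where
  "MH kap l q b c =
     (let p = pmut kap q in
      \<Sum>k\<in>{0..l - b}. \<Sum>j\<in>{0..b}.
        if int k - int j = int c - int b then
          real ((l - b) choose k) * (p * (1 - 1 / real kap)) ^ k
            * (1 - p * (1 - 1 / real kap)) ^ (l - b - k)
            * (real (b choose j)) * (p / real kap) ^ j * (1 - p / real kap) ^ (b - j)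
        else 0)"

text \<open>Coefficients N^theta(b,c), for b in {0..K} \<union> {theta}, c in {0..K};
  theta is either l or K+1.\<close>
definition NT :: "nat \<Rightarrow> real \<Rightarrow> nat \<Rightarrow> nat \<Rightarrow> nat \<Rightarrow> nat \<Rightarrow> nat \<Rightarrow> real" where
  "NT kap q K l th b c =
     (if b \<le> c \<and> b \<le> K then MH kap l q b c
      else if th = l then 0
      else MH kap l q (c + 1) c)"

definition EK :: "nat \<Rightarrow> nat \<Rightarrow> (nat \<Rightarrow> nat) set" where
  "EK K m = {z. (\<forall>i>K. z i = 0) \<and> (\<Sum>i\<le>K. z i) \<le> m}"

definition ssum :: "nat \<Rightarrow> (nat \<Rightarrow> nat) \<Rightarrow> nat" where
  "ssum K z = (\<Sum>i\<le>K. z i)"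

definition DD :: "real \<Rightarrow> nat \<Rightarrow> (nat \<Rightarrow> nat) \<Rightarrow> real" where
  "DD sig m z = real m * ((sig - 1) * real (z 0) + real m)"

definition WW :: "nat \<Rightarrow> real \<Rightarrow> nat \<Rightarrow> nat \<Rightarrow> nat \<Rightarrow> real \<Rightarrow> nat \<Rightarrow> (nat \<Rightarrow> nat) \<Rightarrow> nat \<Rightarrow> real" where
  "WW kap sig K l m q th z j =
     sig * real (z 0) * NT kap q K l th 0 j
     + (\<Sum>i\<in>{1..K}. real (z i) * NT kap q K l th i j)
     + real (m - ssum K z) * NT kap q K l th th j"

definition up :: "nat \<Rightarrow> (nat \<Rightarrow> nat) \<Rightarrow> (nat \<Rightarrow> nat) \<Rightarrow> bool" where
  "up i z z' \<longleftrightarrow> z' i = z i + 1 \<and> (\<forall>h. h \<noteq> i \<longrightarrow> z' h = z h)"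

definition down :: "nat \<Rightarrow> (nat \<Rightarrow> nat) \<Rightarrow> (nat \<Rightarrow> nat) \<Rightarrow> bool" where
  "down i z z' \<longleftrightarrow> z i = z' i + 1 \<and> (\<forall>h. h \<noteq> i \<longrightarrow> z' h = z h)"

definition move :: "nat \<Rightarrow> nat \<Rightarrow> (nat \<Rightarrow> nat) \<Rightarrow> (nat \<Rightarrow> nat) \<Rightarrow> bool" where
  "move i j z z' \<longleftrightarrow> i \<noteq> j \<and> z i = z' i + 1 \<and> z' j = z j + 1
      \<and> (\<forall>h. h \<noteq> i \<and> h \<noteq> j \<longrightarrow> z' h = z h)"

definition poff :: "nat \<Rightarrow> real \<Rightarrow> nat \<Rightarrow> nat \<Rightarrow> nat \<Rightarrow> real \<Rightarrow> nat \<Rightarrow> (nat \<Rightarrow> nat) \<Rightarrow> (nat \<Rightarrow> nat) \<Rightarrow> real" where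
  "poff kap sig K l m q th z z' =
     (\<Sum>i\<le>K. (if up i z z' then real (m - ssum K z) * WW kap sig K l m q th z i / DD sig m z else 0)
       + (if down i z z' then real (z i) * ((sig - 1) * real (z 0) + real m
             - (\<Sum>h\<le>K. WW kap sig K l m q th z h)) / DD sig m z else 0)
       + (\<Sum>j\<le>K. if move i j z z' then real (z i) * WW kap sig K l m q th z j / DD sig m z else 0))"

definition pker :: "nat \<Rightarrow> real \<Rightarrow> nat \<Rightarrow> nat \<Rightarrow> nat \<Rightarrow> real \<Rightarrow> nat \<Rightarrow> (nat \<Rightarrow> nat) \<Rightarrow> (nat \<Rightarrow> nat) \<Rightarrow> real" where
  "pker kap sig K l m q th z z' =
     (if z' = z then 1 - (\<Sum>y\<in>EK K m - {z}. poff kap sig K l m q th z y)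
      else poff kap sig K l m q th z z')"

definition zth :: "nat \<Rightarrow> nat \<Rightarrow> nat \<Rightarrow> nat \<Rightarrow> (nat \<Rightarrow> nat)" where
  "zth K l m th = (if th = l then (\<lambda>h. if h = 0 then 1 else 0)
                   else (\<lambda>h. if h = 0 then 1 else if h = 1 \<and> 1 \<le> K then m - 1 else 0))"

definition zminus :: "nat \<Rightarrow> (nat \<Rightarrow> nat) \<Rightarrow> (nat \<Rightarrow> nat)" where
  "zminus i z = z(i := z i - 1)"

definition zplus :: "nat \<Rightarrow> (nat \<Rightarrow> nat) \<Rightarrow> (nat \<Rightarrow> nat)" where
  "zplus i z = z(i := z i + 1)"

definition pth :: "nat \<Rightarrow> real \<Rightarrow> nat \<Rightarrow> nat \<Rightarrow> nat \<Rightarrow> real \<Rightarrow> nat \<Rightarrow> (nat \<Rightarrow> nat) \<Rightarrow> (nat \<Rightarrow> nat) \<Rightarrow> real" where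
  "pth kap sig K l m q th z z' =
     (if z 0 = 0 then (if z' = zth K l m th then 1 else 0)
      else if z 0 = 1 \<and> z' 0 = 0 then
        (if z' = (\<lambda>_. 0) then
           pker kap sig K l m q th z (zminus 0 z)
           + (\<Sum>i\<in>{1..K}. pker kap sig K l m q th z (zplus i (zminus 0 z)))
         else 0)
      else pker kap sig K l m q th z z')"

definition invariant_prob :: "(nat \<Rightarrow> nat) set \<Rightarrow> ((nat \<Rightarrow> nat) \<Rightarrow> (nat \<Rightarrow> nat) \<Rightarrow> real)
    \<Rightarrow> ((nat \<Rightarrow> nat) \<Rightarrow> real) \<Rightarrow> bool" where
  "invariant_prob E P \<nu> \<longleftrightarrow> (\<forall>z\<in>E. 0 \<le> \<nu> z) \<and> (\<Sum>z\<in>E. \<nu> z) = 1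
      \<and> (\<forall>y\<in>E. (\<Sum>z\<in>E. \<nu> z * P z y) = \<nu> y)"

definition rho_star :: "real \<Rightarrow> real \<Rightarrow> nat \<Rightarrow> real" where
  "rho_star sig a k = (sig * exp (- a) - 1) * a ^ k / fact k
      * (\<Sum>i. real (Suc i) ^ k / sig ^ Suc i)"

end

theory Submission
  imports Defs
begin

text \<open>
  Under the unmodified kernel the coordinate \<open>k\<close> moves by at most one, and its drift is
  \<open>W z k / ((sig - 1) * z 0 + m) - z k / m\<close>. Averages of \<open>P g - g\<close> against an invariant
  measure vanish, so suitable test functions \<open>g\<close> suffice. First,
  \<open>g z = lam ^ z 0\<close> with \<open>lam < 1 < lam * sig * exp (- a)\<close> shows that \<open>z 0 \<le> del * m / 2\<close> has
  exponentially small mass in \<open>m\<close>; hence the modification of the kernel on \<open>z 0 \<le> 1\<close> is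
  negligible even after multiplication by \<open>m\<close>. Then \<open>g z = (z k / m - rho k)\<^sup>2\<close> yields, by
  induction on \<open>k\<close>, that the second moment of \<open>z k / m - rho k\<close> tends to 0: the linearised drift
  contracts with rate at least \<open>1 - exp (- a)\<close> for \<open>k \<ge> 1\<close>, and for \<open>k = 0\<close> with a rate bounded
  below once \<open>z 0 / m\<close> stays away from 0. So \<open>ssum K z / m\<close> converges to the constant in
  mean square, and continuity of \<open>f\<close> concludes.
\<close>

section \<open>Poisson limit of the mutation matrix\<close>

lemma binomial_term_tendsto_poisson:
  fixes L :: "nat \<Rightarrow> nat" and q :: "nat \<Rightarrow> real"
  assumes L: "filterlim L at_top sequentially" and q: "q \<longlonglongrightarrow> 0"
    and q01: "\<And>n. 0 < q n" "\<And>n. q n < 1" and Lq: "(\<lambda>n. real (L n) * q n) \<longlonglongrightarrow> a"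
  shows "(\<lambda>n. real (L n choose k) * q n ^ k * (1 - q n) ^ (L n - k)) \<longlonglongrightarrow> exp (- a) * a ^ k / fact k"
proof -
  have 1: "real (L n choose k) * q n ^ k = (\<Prod>i\<in>{0..<k}. real (L n) * q n - real i * q n) / fact k" for n
  proof -
    have "(\<Prod>i\<in>{0..<k}. real (L n) * q n - real i * q n) = (\<Prod>i\<in>{0..<k}. (real (L n) - real i) * q n)"
      by (simp add: left_diff_distrib)
    also have "\<dots> = (\<Prod>i\<in>{0..<k}. real (L n) - real i) * q n ^ k" by (subst prod.distrib) simp
    finally show ?thesis by (simp add: binomial_gbinomial gbinomial_prod_rev)
  qed
  have "(\<lambda>n. (\<Prod>i\<in>{0..<k}. real (L n) * q n - real i * q n) / fact k)
      \<longlonglongrightarrow> (\<Prod>i\<in>{0..<k}. a - real i * 0) / fact k"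
    by (intro tendsto_intros Lq q) auto
  then have c: "(\<lambda>n. real (L n choose k) * q n ^ k) \<longlonglongrightarrow> a ^ k / fact k"
    unfolding 1 by simp
  have "((\<lambda>x::real. ln (1 - x)) has_real_derivative -1) (at 0)"
    by (auto intro!: derivative_eq_intros)
  then have "((\<lambda>x::real. ln (1 - x) / x) \<longlongrightarrow> -1) (at 0)" by (simp add: DERIV_def)
  moreover have "filterlim q (at 0) sequentially"
    using q q01(1) by (auto simp: filterlim_at eventually_sequentially less_imp_neq[symmetric])
  ultimately have "(\<lambda>n. ln (1 - q n) / q n) \<longlonglongrightarrow> -1" by (rule filterlim_compose)
  then have "(\<lambda>n. exp ((real (L n) * q n) * (ln (1 - q n) / q n))) \<longlonglongrightarrow> exp (a * -1)"
    by (intro tendsto_intros Lq)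
  moreover have "exp ((real (L n) * q n) * (ln (1 - q n) / q n)) = (1 - q n) ^ L n" for n
    using q01[of n] by (simp add: exp_of_nat_mult)
  ultimately have p: "(\<lambda>n. (1 - q n) ^ L n) \<longlonglongrightarrow> exp (- a)" by simp
  have pk: "(\<lambda>n. (1 - q n) ^ k) \<longlonglongrightarrow> (1 - 0) ^ k" by (intro tendsto_intros q)
  have "(\<lambda>n. real (L n choose k) * q n ^ k * ((1 - q n) ^ L n / (1 - q n) ^ k))
     \<longlonglongrightarrow> a ^ k / fact k * (exp (- a) / (1 - 0) ^ k)"
    by (intro tendsto_mult c tendsto_divide p pk) simp
  moreover have "eventually (\<lambda>n. real (L n choose k) * q n ^ k * ((1 - q n) ^ L n / (1 - q n) ^ k)
       = real (L n choose k) * q n ^ k * (1 - q n) ^ (L n - k)) sequentially"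
    using L[unfolded filterlim_at_top, rule_format, of k]
  proof eventually_elim
    case (elim n)
    then show ?case using q01[of n] by (simp add: power_diff)
  qed
  ultimately have "(\<lambda>n. real (L n choose k) * q n ^ k * (1 - q n) ^ (L n - k)) \<longlonglongrightarrow> a ^ k / fact k * (exp (- a) / (1 - 0) ^ k)"
    by (rule Lim_transform_eventually)
  then show ?thesis by (simp add: mult.commute)
qed

lemma MH_eq:
  assumes kap: "kap \<ge> 2"
  shows "MH kap l q b c = (\<Sum>j\<in>{0..b}. if b \<le> c + j then
     (real ((l - b) choose (c + j - b)) * q ^ (c + j - b) * (1 - q) ^ (l - b - (c + j - b)))
       * real (b choose j) * (q / (real kap - 1)) ^ j * (1 - q / (real kap - 1)) ^ (b - j) else 0)"
proof -
  have p: "pmut kap q * (1 - 1 / real kap) = q" "pmut kap q / real kap = q / (real kap - 1)"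
    using kap by (auto simp: pmut_def field_simps)
  have col: "(\<Sum>k\<in>{0..l - b}. if int k - int j = int c - int b then F k else 0)
     = (if b \<le> c + j then F (c + j - b) else 0)" if "\<And>k. l - b < k \<Longrightarrow> F k = 0" for j and F :: "nat \<Rightarrow> real"
  proof -
    have "(\<Sum>k\<in>{0..l - b}. if int k - int j = int c - int b then F k else 0)
      = (\<Sum>k\<in>{0..l - b}. if k = c + j - b then (if b \<le> c + j then F (c + j - b) else 0) else 0)"
      by (intro sum.cong) auto
    then show ?thesis using that by (auto simp: not_le)
  qed
  show ?thesis
    unfolding MH_def Let_def p by (subst sum.swap, intro sum.cong refl, subst col) auto
qed

lemma MH_nonneg:
  assumes kap: "kap \<ge> 2" and q: "0 < q" "q < 1 - 1 / real kap"
  shows "0 \<le> MH kap l q b c"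
proof -
  have "q * real kap < real kap - 1" using q kap by (simp add: field_simps)
  moreover have "q * 1 \<le> q * real kap" using q kap by (intro mult_left_mono) auto
  ultimately have "q / (real kap - 1) \<le> 1" using kap by (simp add: divide_le_eq)
  moreover have "q < 1" using q by (smt (verit) divide_nonneg_nonneg of_nat_0_le_iff)
  ultimately show ?thesis
    unfolding MH_eq[OF kap] using q kap by (intro sum_nonneg) auto
qed

definition poisson_mutation :: "real \<Rightarrow> nat \<Rightarrow> nat \<Rightarrow> real" where
  "poisson_mutation a b c = (if b \<le> c then exp (- a) * a ^ (c - b) / fact (c - b) else 0)"

lemma MH_tendsto:
  fixes l :: "nat \<Rightarrow> nat" and q :: "nat \<Rightarrow> real"
  assumes kap: "kap \<ge> 2" and l: "filterlim l at_top sequentially" and q: "q \<longlonglongrightarrow> 0"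
    and q01: "\<And>n. 0 < q n" "\<And>n. q n < 1" and lq: "(\<lambda>n. real (l n) * q n) \<longlonglongrightarrow> a"
  shows "(\<lambda>n. MH kap (l n) (q n) b c) \<longlonglongrightarrow> poisson_mutation a b c"
proof -
  have L: "filterlim (\<lambda>n. l n - b) at_top sequentially"
    unfolding filterlim_at_top
  proof
    fix Z
    show "\<forall>\<^sub>F n in sequentially. Z \<le> l n - b"
      using l[unfolded filterlim_at_top, rule_format, of "Z + b"] by eventually_elim simp
  qed
  have "(\<lambda>n. real (l n) * q n - real b * q n) \<longlonglongrightarrow> a - real b * 0" by (intro tendsto_intros lq q)
  moreover have "\<forall>\<^sub>F n in sequentially. real (l n) * q n - real b * q n = real (l n - b) * q n"
    using l[unfolded filterlim_at_top, rule_format, of b] by eventually_elim (simp add: of_nat_diff left_diff_distrib)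
  ultimately have Lq: "(\<lambda>n. real (l n - b) * q n) \<longlonglongrightarrow> a"
    using Lim_transform_eventually by fastforce
  note pois = binomial_term_tendsto_poisson[OF L q q01 Lq]
  have "(\<lambda>n. MH kap (l n) (q n) b c) \<longlonglongrightarrow> (\<Sum>j\<in>{0..b}. if b \<le> c + j then
     (exp (- a) * a ^ (c + j - b) / fact (c + j - b)) * real (b choose j) * (0 / (real kap - 1)) ^ j
        * (1 - 0 / (real kap - 1)) ^ (b - j) else 0)"
    unfolding MH_eq[OF kap]
  proof (intro tendsto_sum)
    fix j
    show "(\<lambda>n. if b \<le> c + j then
     (real ((l n - b) choose (c + j - b)) * q n ^ (c + j - b) * (1 - q n) ^ (l n - b - (c + j - b)))
       * real (b choose j) * (q n / (real kap - 1)) ^ j * (1 - q n / (real kap - 1)) ^ (b - j) else 0)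
      \<longlonglongrightarrow> (if b \<le> c + j then (exp (- a) * a ^ (c + j - b) / fact (c + j - b)) * real (b choose j)
         * (0 / (real kap - 1)) ^ j * (1 - 0 / (real kap - 1)) ^ (b - j) else 0)"
    proof (cases "b \<le> c + j")
      case True
      then show ?thesis
        by (simp only: if_True, intro pois tendsto_mult tendsto_power tendsto_diff tendsto_divide tendsto_const q)
          (use kap in auto)
    qed simp
  qed
  also have "(\<Sum>j\<in>{0..b}. if b \<le> c + j then
     (exp (- a) * a ^ (c + j - b) / fact (c + j - b)) * real (b choose j) * (0 / (real kap - 1)) ^ j
        * (1 - 0 / (real kap - 1)) ^ (b - j) else 0) = (\<Sum>j\<in>{0..b}. if j = 0 then poisson_mutation a b c else 0)"
    by (intro sum.cong) (auto simp: poisson_mutation_def)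
  finally show ?thesis by simp
qed

lemma summable_power_over_exponential:
  assumes "sig > (1::real)"
  shows "summable (\<lambda>i. real (Suc i) ^ k / sig ^ Suc i)"
proof -
  define c where "c = (1 + 1 / sig) / 2"
  have c: "c < 1" "1 < c * sig" using assms by (auto simp: c_def field_simps)
  have "(\<lambda>n. (1 + inverse (real (Suc n))) ^ k) \<longlonglongrightarrow> (1 + 0) ^ k"
    by (intro tendsto_intros LIMSEQ_inverse_real_of_nat)
  then have "\<forall>\<^sub>F n in sequentially. (1 + inverse (real (Suc n))) ^ k < c * sig"
    using order_tendstoD(2)[OF _ c(2)] by simp
  then obtain N where N: "\<And>n. n \<ge> N \<Longrightarrow> (1 + inverse (real (Suc n))) ^ k < c * sig"
    by (auto simp: eventually_sequentially)
  show ?thesis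
  proof (rule summable_ratio_test[OF c(1), of N])
    fix n assume "N \<le> n"
    have "real (Suc (Suc n)) ^ k = (real (Suc n) * (1 + inverse (real (Suc n)))) ^ k"
      by (rule arg_cong[where f = "\<lambda>x. x ^ k"]) (simp add: field_simps)
    also have "\<dots> \<le> real (Suc n) ^ k * (c * sig)"
      unfolding power_mult_distrib using N[OF \<open>N \<le> n\<close>] by (intro mult_left_mono) auto
    finally show "norm (real (Suc (Suc n)) ^ k / sig ^ Suc (Suc n)) \<le> c * norm (real (Suc n) ^ k / sig ^ Suc n)"
      using assms by (simp add: field_simps)
  qed
qed

lemma rho_star_zero:
  assumes "sig > 1"
  shows "rho_star sig a 0 = (sig * exp (- a) - 1) / (sig - 1)"
proof -
  have "(\<lambda>i. (1 / sig) * (1 / sig) ^ i) sums ((1 / sig) * (1 / (1 - 1 / sig)))"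
    by (intro sums_mult geometric_sums) (use assms in auto)
  moreover have "(\<lambda>i. (1 / sig) * (1 / sig) ^ i) = (\<lambda>i. real (Suc i) ^ 0 / sig ^ Suc i)"
    by (simp add: power_divide)
  ultimately have "(\<Sum>i. real (Suc i) ^ 0 / sig ^ Suc i) = (1 / sig) * (1 / (1 - 1 / sig))"
    by (metis sums_unique)
  also have "\<dots> = 1 / (sig - 1)" using assms by (simp add: field_simps)
  finally show ?thesis by (simp add: rho_star_def)
qed

lemma rho_star_recursion:
  assumes sig: "sig > 1"
  shows "sig * rho_star sig a k = (sig - 1) * rho_star sig a 0 * a ^ k / fact k
     + (\<Sum>j\<le>k. rho_star sig a j * a ^ (k - j) / fact (k - j))"
proof -
  define S where "S j = (\<Sum>i. real (Suc i) ^ j / sig ^ Suc i)" for j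
  let ?C = "sig * exp (- a) - 1"
  have rho: "rho_star sig a j = ?C * a ^ j / fact j * S j" for j
    unfolding rho_star_def S_def ..
  note summ = summable_power_over_exponential[OF sig]
  have "(\<Sum>i. real (Suc (Suc i)) ^ k / sig ^ Suc (Suc i)) = S k - 1 / sig"
    unfolding S_def by (subst suminf_split_head[OF summ]) simp
  then have "sig * (S k - 1 / sig) = (\<Sum>i. sig * (real (Suc (Suc i)) ^ k / sig ^ Suc (Suc i)))"
    using summ[of k] by (subst suminf_mult) (auto simp: summable_Suc_iff[where f = "\<lambda>i. real (Suc i) ^ k / sig ^ Suc i"] simp del: power_Suc of_nat_Suc)
  also have "\<dots> = (\<Sum>i. \<Sum>j\<le>k. real (k choose j) * (real (Suc i) ^ j / sig ^ Suc i))"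
  proof (rule suminf_cong)
    fix i
    have "real (Suc (Suc i)) ^ k = (real (Suc i) + 1) ^ k" by (simp add: add.commute)
    also have "\<dots> = (\<Sum>j\<le>k. real (k choose j) * real (Suc i) ^ j)" by (subst binomial_ring) simp
    finally show "sig * (real (Suc (Suc i)) ^ k / sig ^ Suc (Suc i)) = (\<Sum>j\<le>k. real (k choose j) * (real (Suc i) ^ j / sig ^ Suc i))"
      using sig by (simp add: sum_divide_distrib sum_distrib_left)
  qed
  also have "\<dots> = (\<Sum>j\<le>k. \<Sum>i. real (k choose j) * (real (Suc i) ^ j / sig ^ Suc i))"
    by (rule suminf_sum) (intro summable_mult summ)
  also have "\<dots> = (\<Sum>j\<le>k. real (k choose j) * S j)"
    unfolding S_def by (intro sum.cong refl suminf_mult summ)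
  finally have bin: "(\<Sum>j\<le>k. real (k choose j) * S j) = sig * S k - 1" using sig by (simp add: right_diff_distrib)
  have "(\<Sum>j\<le>k. rho_star sig a j * a ^ (k - j) / fact (k - j)) = (\<Sum>j\<le>k. ?C * a ^ k / fact k * (real (k choose j) * S j))"
  proof (intro sum.cong refl)
    fix j assume "j \<in> {..k}"
    then have j: "j \<le> k" by simp
    then have "a ^ k = a ^ j * a ^ (k - j)" by (simp flip: power_add)
    then show "rho_star sig a j * a ^ (k - j) / fact (k - j) = ?C * a ^ k / fact k * (real (k choose j) * S j)"
      using j by (simp add: rho binomial_fact)
  qed
  also have "\<dots> = ?C * a ^ k / fact k * (sig * S k - 1)" by (simp only: sum_distrib_left[symmetric] bin)
  finally show ?thesis
    using sig by (simp add: rho_star_zero[OF sig]) (simp add: rho field_simps)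
qed

section \<open>The chain for fixed parameters\<close>

lemma finite_EK: "finite (EK K m)"
proof (rule finite_subset)
  show "EK K m \<subseteq> {f. \<forall>x. (x \<in> {..K} \<longrightarrow> f x \<in> {..m}) \<and> (x \<notin> {..K} \<longrightarrow> f x = 0)}"
  proof (clarsimp simp: EK_def not_le)
    fix z :: "nat \<Rightarrow> nat" and i
    assume "(\<Sum>i\<le>K. z i) \<le> m" "i \<le> K"
    with member_le_sum[of i "{..K}" z] show "z i \<le> m" by simp
  qed
  show "finite {f. \<forall>x. (x \<in> {..K} \<longrightarrow> f x \<in> {..m}) \<and> (x \<notin> {..K} \<longrightarrow> f x = (0::nat))}"
    by (rule finite_set_of_finite_funs) auto
qed

lemma up_iff: "up i z z' \<longleftrightarrow> z' = zplus i z"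
  unfolding up_def zplus_def fun_eq_iff by auto

lemma down_iff: "down i z z' \<longleftrightarrow> 0 < z i \<and> z' = zminus i z"
  unfolding down_def zminus_def fun_eq_iff by auto

lemma move_iff: "move i j z z' \<longleftrightarrow> i \<noteq> j \<and> 0 < z i \<and> z' = zplus j (zminus i z)"
  unfolding move_def zminus_def zplus_def fun_eq_iff by auto

lemma ssum_zplus: "i \<le> K \<Longrightarrow> ssum K (zplus i z) = ssum K z + 1"
  by (simp add: ssum_def zplus_def sum.remove[where x = i])

lemma ssum_zminus: "i \<le> K \<Longrightarrow> 0 < z i \<Longrightarrow> ssum K (zminus i z) + 1 = ssum K z"
  by (simp add: ssum_def zminus_def sum.remove[where x = i])

lemma EK_iff: "z \<in> EK K m \<longleftrightarrow> (\<forall>i>K. z i = 0) \<and> ssum K z \<le> m"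
  by (simp add: EK_def ssum_def)

lemma EK_le: "z \<in> EK K m \<Longrightarrow> z i \<le> m"
  using member_le_sum[of i "{..K}" z] by (cases "i \<le> K") (auto simp: EK_def)

lemma zplus_EK: "z \<in> EK K m \<Longrightarrow> i \<le> K \<Longrightarrow> ssum K z < m \<Longrightarrow> zplus i z \<in> EK K m"
  by (auto simp: EK_iff ssum_zplus) (simp add: zplus_def)

lemma zminus_EK:
  assumes "z \<in> EK K m" "i \<le> K" "0 < z i"
  shows "zminus i z \<in> EK K m" "ssum K (zminus i z) < m"
  using assms ssum_zminus[of i K z] by (auto simp: EK_iff) (simp add: zminus_def)

definition total_fitness :: "real \<Rightarrow> nat \<Rightarrow> (nat \<Rightarrow> nat) \<Rightarrow> real" where
  "total_fitness sig m z = (sig - 1) * real (z 0) + real m"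

definition energy_const :: "real \<Rightarrow> nat \<Rightarrow> real \<Rightarrow> real" where
  "energy_const sig K r = ((real K + 1) * (sig * (4 * real K + 7)) + 1) * (2 * (2 + \<bar>r\<bar>)\<^sup>2)
     + (1 + \<bar>r\<bar>) * (1 + 2 * sig)"

locale lumped_chain =
  fixes kap :: nat and sig :: real and K l m :: nat and q :: real and th :: nat
  assumes sig: "sig > 1" and m: "m \<ge> 2"
    and NT_nonneg: "\<And>b c. c \<le> K \<Longrightarrow> 0 \<le> NT kap q K l th b c"
    and NT_le: "\<And>b c. c \<le> K \<Longrightarrow> NT kap q K l th b c \<le> 2"
begin

abbreviation "E \<equiv> EK K m"
abbreviation "W \<equiv> WW kap sig K l m q th"
abbreviation "D \<equiv> DD sig m"
abbreviation "Q \<equiv> total_fitness sig m"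
abbreviation "P \<equiv> pth kap sig K l m q th"

definition up_rate :: "nat \<Rightarrow> (nat \<Rightarrow> nat) \<Rightarrow> real" where
  "up_rate i z = real (m - ssum K z) * W z i / D z"

definition down_rate :: "nat \<Rightarrow> (nat \<Rightarrow> nat) \<Rightarrow> real" where
  "down_rate i z = real (z i) * (Q z - (\<Sum>h\<le>K. W z h)) / D z"

definition move_rate :: "nat \<Rightarrow> nat \<Rightarrow> (nat \<Rightarrow> nat) \<Rightarrow> real" where
  "move_rate i j z = real (z i) * W z j / D z"

definition jump_sum :: "((nat \<Rightarrow> nat) \<Rightarrow> real) \<Rightarrow> (nat \<Rightarrow> nat) \<Rightarrow> real" where
  "jump_sum g z = (\<Sum>i\<le>K. up_rate i z * g (zplus i z) + down_rate i z * g (zminus i z)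
      + (\<Sum>j\<in>{..K}-{i}. move_rate i j z * g (zplus j (zminus i z))))"

lemma poff_rates:
  "poff kap sig K l m q th z y = (\<Sum>i\<le>K. (if y = zplus i z then up_rate i z else 0)
     + (if 0 < z i \<and> y = zminus i z then down_rate i z else 0)
     + (\<Sum>j\<in>{..K}-{i}. if 0 < z i \<and> y = zplus j (zminus i z) then move_rate i j z else 0))"
proof -
  have *: "(\<Sum>j\<le>K. if move i j z y then real (z i) * W z j / D z else 0)
     = (\<Sum>j\<in>{..K}-{i}. if 0 < z i \<and> y = zplus j (zminus i z) then move_rate i j z else 0)" for i
    by (rule sum.mono_neutral_cong_right) (auto simp: move_iff move_rate_def)
  show ?thesis
    unfolding poff_def * up_iff down_iff up_rate_def down_rate_def total_fitness_def by simp
qed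

lemma poff_sum:
  assumes z: "z \<in> E"
  shows "(\<Sum>y\<in>E. poff kap sig K l m q th z y * g y) = jump_sum g z"
proof -
  have single: "(\<Sum>y\<in>E. (if A \<and> y = v then r else 0) * g y) = r * g v"
    if "A \<Longrightarrow> v \<in> E \<or> r = 0" "\<not> A \<Longrightarrow> r = 0" for A v r
  proof -
    have "(\<Sum>y\<in>E. (if A \<and> y = v then r else 0) * g y) = (\<Sum>y\<in>E. if y = v then (if A then r * g v else 0) else 0)"
      by (intro sum.cong) auto
    also have "\<dots> = r * g v" using that by (auto simp: finite_EK)
    finally show ?thesis .
  qed
  have u: "(\<Sum>y\<in>E. (if y = zplus i z then up_rate i z else 0) * g y) = up_rate i z * g (zplus i z)"
    if "i \<le> K" for i
    using single[of True "zplus i z" "up_rate i z"] zplus_EK[OF z that]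
    by (cases "ssum K z < m") (auto simp: up_rate_def)
  have d: "(\<Sum>y\<in>E. (if 0 < z i \<and> y = zminus i z then down_rate i z else 0) * g y) = down_rate i z * g (zminus i z)"
    if "i \<le> K" for i
    by (rule single) (use zminus_EK[OF z that] in \<open>auto simp: down_rate_def\<close>)
  have mv: "(\<Sum>y\<in>E. (if 0 < z i \<and> y = zplus j (zminus i z) then move_rate i j z else 0) * g y)
     = move_rate i j z * g (zplus j (zminus i z))" if "i \<le> K" "j \<le> K" for i j
    by (rule single) (use zminus_EK[OF z that(1)] zplus_EK that(2) in \<open>auto simp: move_rate_def\<close>)
  have "(\<Sum>y\<in>E. poff kap sig K l m q th z y * g y)
    = (\<Sum>i\<le>K. (\<Sum>y\<in>E. (if y = zplus i z then up_rate i z else 0) * g y)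
       + (\<Sum>y\<in>E. (if 0 < z i \<and> y = zminus i z then down_rate i z else 0) * g y)
       + (\<Sum>j\<in>{..K}-{i}. \<Sum>y\<in>E. (if 0 < z i \<and> y = zplus j (zminus i z) then move_rate i j z else 0) * g y))"
    unfolding poff_rates sum_distrib_right
    apply (subst sum.swap)
    apply (rule sum.cong[OF refl])
    apply (simp only: distrib_right sum.distrib sum_distrib_right)
    apply (subst (2) sum.swap)
    apply (rule refl)
    done
  also have "\<dots> = jump_sum g z"
    unfolding jump_sum_def by (intro sum.cong refl arg_cong2[where f = "(+)"]) (auto simp: u d mv)
  finally show ?thesis .
qed

lemma zplus_neq: "zplus i z \<noteq> z"
  by (metis fun_upd_same n_not_Suc_n Suc_eq_plus1 zplus_def)

lemma zminus_neq: "0 < z i \<Longrightarrow> zminus i z \<noteq> z"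
  by (metis Suc_pred' fun_upd_same n_not_Suc_n zminus_def)

lemma poff_self: "poff kap sig K l m q th z z = 0"
proof -
  have "zplus j (zminus i z) \<noteq> z" if "0 < z i" "j \<noteq> i" for i j
    using that by (auto simp: zplus_def zminus_def fun_eq_iff)
  then show ?thesis
    unfolding poff_rates using zplus_neq zminus_neq
    by (intro sum.neutral ballI) (auto intro!: sum.neutral, metis+)
qed

lemma pker_sum:
  assumes z: "z \<in> E"
  shows "(\<Sum>y\<in>E. pker kap sig K l m q th z y * g y) = g z + jump_sum (\<lambda>y. g y - g z) z"
proof -
  have "(\<Sum>y\<in>E. pker kap sig K l m q th z y * g y)
     = pker kap sig K l m q th z z * g z + (\<Sum>y\<in>E - {z}. poff kap sig K l m q th z y * g y)"
    by (subst sum.remove[OF finite_EK z]) (auto simp: pker_def intro!: sum.cong)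
  also have "\<dots> = g z + (\<Sum>y\<in>E - {z}. poff kap sig K l m q th z y * (g y - g z))"
    by (simp add: pker_def algebra_simps sum_subtractf sum_distrib_left)
  also have "(\<Sum>y\<in>E - {z}. poff kap sig K l m q th z y * (g y - g z)) = (\<Sum>y\<in>E. poff kap sig K l m q th z y * (g y - g z))"
    by (subst sum.remove[OF finite_EK z]) (auto simp: poff_self)
  finally show ?thesis using poff_sum[OF z] by simp
qed

text \<open>Coalescing all targets with vanishing 0-th entry into the zero vector turns the kernel
  \<open>pth\<close> on \<open>z 0 = 1\<close> into the unmodified kernel acting on another test function.\<close>

lemma P_sum:
  assumes z: "z \<in> E" and pos: "0 < z 0"
  shows "(\<Sum>y\<in>E. P z y * g y) = g z
     + jump_sum (\<lambda>y. (if z 0 = 1 \<and> y 0 = 0 then g (\<lambda>_. 0) else g y) - g z) z"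
proof (cases "z 0 = 1")
  case False
  then show ?thesis using pos pker_sum[OF z, of g] by (simp add: pth_def)
next
  case True
  let ?p = "pker kap sig K l m q th z"
  let ?h = "\<lambda>y. if y 0 = 0 then g (\<lambda>_. 0) else g y"
  let ?S = "insert (zminus 0 z) ((\<lambda>i. zplus i (zminus 0 z)) ` {1..K})"
  have zero: "(\<lambda>_. 0) \<in> E" by (simp add: EK_def)
  have m0: "zminus 0 z \<in> E" "zminus 0 z 0 = 0" using True zminus_EK[OF z, of 0] by (auto simp: zminus_def)
  have inj: "inj_on (\<lambda>i. zplus i (zminus 0 z)) {1..K}"
    by (rule inj_onI) (metis fun_upd_same fun_upd_other n_not_Suc_n Suc_eq_plus1 zplus_def)
  have sub: "?S \<subseteq> {y\<in>E. y 0 = 0}"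
    using m0 zplus_EK[OF m0(1)] zminus_EK(2)[OF z, of 0] True by (auto simp: zplus_def)
  have vanish: "?p y = 0" if "y \<in> {y\<in>E. y 0 = 0} - ?S" for y
  proof -
    have y: "y 0 = 0" "y \<noteq> zminus 0 z" "\<And>i. i \<in> {1..K} \<Longrightarrow> y \<noteq> zplus i (zminus 0 z)" using that by auto
    have "y \<noteq> z" using y True by auto
    moreover have "y \<noteq> zplus i z" for i using y(1) True by (auto simp: zplus_def split: if_splits)
    moreover have "y \<noteq> zminus i z" for i using y(1,2) True by (cases "i = 0") (auto simp: zminus_def)
    moreover have "y \<noteq> zplus j (zminus i z)" if "j \<in> {..K}-{i}" for i j
    proof (cases "i = 0")
      case i: True
      then show ?thesis using y(3)[of j] that by auto
    next
      case False
      then have "0 < zplus j (zminus i z) 0" using True by (simp add: zplus_def zminus_def)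
      then show ?thesis using y(1) by auto
    qed
    ultimately have "poff kap sig K l m q th z y = 0"
      unfolding poff_rates by (intro sum.neutral ballI) (simp add: sum.neutral)
    with \<open>y \<noteq> z\<close> show ?thesis by (simp add: pker_def)
  qed
  have "(\<Sum>y\<in>{y\<in>E. y 0 = 0}. ?p y) = (\<Sum>y\<in>?S. ?p y)"
    using sub vanish by (intro sum.mono_neutral_right) (auto simp: finite_EK)
  also have "\<dots> = ?p (zminus 0 z) + (\<Sum>i\<in>{1..K}. ?p (zplus i (zminus 0 z)))"
    by (subst sum.insert) (use zplus_neq inj in \<open>auto simp: sum.reindex\<close>, metis)
  finally have tot: "(\<Sum>y\<in>{y\<in>E. y 0 = 0}. ?p y) = P z (\<lambda>_. 0)" using True by (simp add: pth_def)
  have "(\<Sum>y\<in>E. P z y * g y) = (\<Sum>y\<in>{y\<in>E. y 0 = 0}. P z y * g y) + (\<Sum>y\<in>{y\<in>E. y 0 \<noteq> 0}. P z y * g y)"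
    by (subst sum.union_disjoint[symmetric]) (auto simp: finite_EK intro!: sum.cong)
  also have "(\<Sum>y\<in>{y\<in>E. y 0 = 0}. P z y * g y) = (\<Sum>y\<in>{\<lambda>_. 0}. P z y * g y)"
    using zero True by (intro sum.mono_neutral_right) (auto simp: finite_EK pth_def)
  also have "\<dots> = (\<Sum>y\<in>{y\<in>E. y 0 = 0}. ?p y * ?h y)"
    by (simp add: tot[symmetric] sum_distrib_right)
  also have "(\<Sum>y\<in>{y\<in>E. y 0 \<noteq> 0}. P z y * g y) = (\<Sum>y\<in>{y\<in>E. y 0 \<noteq> 0}. ?p y * ?h y)"
    using True by (intro sum.cong) (auto simp: pth_def)
  also have "(\<Sum>y\<in>{y\<in>E. y 0 = 0}. ?p y * ?h y) + (\<Sum>y\<in>{y\<in>E. y 0 \<noteq> 0}. ?p y * ?h y) = (\<Sum>y\<in>E. ?p y * ?h y)"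
    by (subst sum.union_disjoint[symmetric]) (auto simp: finite_EK intro!: sum.cong)
  also have "\<dots> = ?h z + jump_sum (\<lambda>y. ?h y - ?h z) z" by (rule pker_sum[OF z])
  finally show ?thesis using True by simp
qed

lemma zth_EK: "zth K l m th \<in> E"
proof -
  have "(\<Sum>i\<le>K. if i = 0 then 1 else if i = 1 \<and> 1 \<le> K then m - 1 else 0) \<le> m"
  proof (cases K)
    case (Suc k)
    have "(\<Sum>i\<le>K. if i = 0 then 1 else if i = 1 \<and> 1 \<le> K then m - 1 else 0)
       = (\<Sum>i\<le>K. (if i = 0 then 1 else 0) + (if i = 1 then m - 1 else 0))"
      using Suc by (intro sum.cong) auto
    also have "\<dots> = m" using Suc m by (simp add: sum.distrib)
    finally show ?thesis by simp
  qed (use m in auto)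
  then show ?thesis using m by (auto simp: zth_def EK_def)
qed

lemma P_sum_zero: "z 0 = 0 \<Longrightarrow> (\<Sum>y\<in>E. P z y * g y) = g (zth K l m th)"
  using zth_EK by (simp add: pth_def if_distrib[of "\<lambda>r. r * _"] finite_EK cong: if_cong)

lemma jump_sum_coord:
  assumes z: "z \<in> E" and k: "k \<le> K"
    and g: "\<And>y. y k = z k \<Longrightarrow> g y = 0"
      "\<And>y. y k = z k + 1 \<Longrightarrow> g y = u" "\<And>y. y k = z k - 1 \<Longrightarrow> g y = d"
  shows "jump_sum g z = (real m - real (z k)) * W z k / D z * u + real (z k) * (Q z - W z k) / D z * d"
proof -
  have zp: "up_rate i z * g (zplus i z) = (if i = k then up_rate k z * u else 0)" for i
    using g by (auto simp: zplus_def)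
  have zm: "down_rate i z * g (zminus i z) = (if i = k then down_rate k z * d else 0)" for i
    using g by (auto simp: zminus_def)
  have mv: "(\<Sum>j\<in>{..K}-{i}. move_rate i j z * g (zplus j (zminus i z)))
     = (if i = k then (\<Sum>j\<in>{..K}-{k}. move_rate k j z) * d else move_rate i k z * u)" if "i \<le> K" for i
  proof (cases "i = k")
    case True
    then show ?thesis using g by (auto simp: zminus_def zplus_def sum_distrib_right intro!: sum.cong)
  next
    case False
    then have "(\<Sum>j\<in>{..K}-{i}. move_rate i j z * g (zplus j (zminus i z))) = (\<Sum>j\<in>{..K}-{i}. if j = k then move_rate i k z * u else 0)"
      using g by (intro sum.cong) (auto simp: zminus_def zplus_def)
    then show ?thesis using False k by simp
  qed
  have *: "jump_sum g z = (\<Sum>i\<le>K. (if i = k then up_rate k z * u else 0) + (if i = k then down_rate k z * d else 0)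
      + (if i = k then (\<Sum>j\<in>{..K}-{k}. move_rate k j z) * d else move_rate i k z * u))"
    unfolding jump_sum_def by (intro sum.cong refl) (simp only: zp zm mv atMost_iff)
  have m1: "(\<Sum>i\<in>{..K}-{k}. move_rate i k z) = (real (ssum K z) - real (z k)) * W z k / D z"
    using k by (simp add: move_rate_def ssum_def sum_divide_distrib[symmetric] sum_distrib_right[symmetric] sum_diff1)
  have m2: "(\<Sum>j\<in>{..K}-{k}. move_rate k j z) = real (z k) * ((\<Sum>h\<le>K. W z h) - W z k) / D z"
    using k by (simp add: move_rate_def sum_divide_distrib[symmetric] sum_distrib_left[symmetric] sum_diff1)
  have "ssum K z \<le> m" using z by (simp add: EK_iff)
  have "jump_sum g z = up_rate k z * u + down_rate k z * d + (\<Sum>j\<in>{..K}-{k}. move_rate k j z) * d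
      + (\<Sum>i\<in>{..K}-{k}. move_rate i k z) * u"
    unfolding * using k by (simp add: sum.distrib sum.remove[of "{..K}" k] sum_distrib_right)
  also have "\<dots> = (real (m - ssum K z) + (real (ssum K z) - real (z k))) * (W z k / D z) * u
      + real (z k) * (Q z - (\<Sum>h\<le>K. W z h) + ((\<Sum>h\<le>K. W z h) - W z k)) * (1 / D z) * d"
    unfolding m1 m2 up_rate_def down_rate_def by (simp add: algebra_simps add_divide_distrib diff_divide_distrib)
  also have "real (m - ssum K z) = real m - real (ssum K z)" using \<open>ssum K z \<le> m\<close> by simp
  finally show ?thesis by simp
qed

definition gen :: "((nat \<Rightarrow> nat) \<Rightarrow> real) \<Rightarrow> (nat \<Rightarrow> nat) \<Rightarrow> real" where
  "gen g z = (\<Sum>y\<in>E. P z y * g y) - g z"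

lemma sum_gen_invariant:
  assumes "invariant_prob E P \<nu>"
  shows "(\<Sum>z\<in>E. \<nu> z * gen g z) = 0"
proof -
  have "(\<Sum>z\<in>E. \<nu> z * (\<Sum>y\<in>E. P z y * g y)) = (\<Sum>y\<in>E. (\<Sum>z\<in>E. \<nu> z * P z y) * g y)"
    by (simp add: sum_distrib_left sum_distrib_right mult.assoc) (rule sum.swap)
  also have "\<dots> = (\<Sum>y\<in>E. \<nu> y * g y)" using assms by (intro sum.cong) (auto simp: invariant_prob_def)
  finally show ?thesis by (simp add: gen_def right_diff_distrib sum_subtractf)
qed

lemma gen_coord:
  assumes z: "z \<in> E" and k: "k \<le> K" and z0: "2 \<le> z 0 \<or> 0 < z 0 \<and> k = 0"
  shows "gen (\<lambda>y. h (y k)) z = (real m - real (z k)) * W z k / D z * (h (z k + 1) - h (z k))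
     + real (z k) * (Q z - W z k) / D z * (h (z k - 1) - h (z k))"
proof -
  have "0 < z 0" using z0 by auto
  note P = P_sum[OF z this, of "\<lambda>y. h (y k)"]
  show ?thesis unfolding gen_def P add_diff_cancel_left'
    by (rule jump_sum_coord[OF z k]) (use z0 in auto)
qed

lemma W_ge: "j \<le> K \<Longrightarrow> sig * real (z 0) * NT kap q K l th 0 j \<le> W z j"
  using sig NT_nonneg by (auto simp: WW_def add.assoc intro!: add_nonneg_nonneg sum_nonneg mult_nonneg_nonneg)

lemma W_nonneg: "j \<le> K \<Longrightarrow> 0 \<le> W z j"
  using W_ge[of j z] sig NT_nonneg[of j 0] by (smt (verit) mult_nonneg_nonneg of_nat_0_le_iff)

lemma ssum_split: "ssum K z = z 0 + (\<Sum>i\<in>{1..K}. z i)"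
  by (simp add: ssum_def atMost_atLeast0 sum.atLeast_Suc_atMost)

lemma W_le:
  assumes "z \<in> E" "j \<le> K"
  shows "W z j \<le> 2 * sig * real m"
proof -
  have N: "0 \<le> NT kap q K l th b j" "NT kap q K l th b j \<le> 2" "NT kap q K l th b j \<le> 2 * sig" for b
    using NT_nonneg NT_le assms sig by (auto intro: order_trans[OF NT_le])
  have "sig * real (z 0) * NT kap q K l th 0 j \<le> sig * real (z 0) * 2"
    using N sig by (intro mult_left_mono) auto
  moreover have "(\<Sum>i\<in>{1..K}. real (z i) * NT kap q K l th i j) \<le> 2 * sig * (\<Sum>i\<in>{1..K}. real (z i))"
    unfolding sum_distrib_left mult.commute[of "2 * sig"] using N by (intro sum_mono mult_left_mono) auto
  moreover have "real (m - ssum K z) * NT kap q K l th th j \<le> real (m - ssum K z) * (2 * sig)"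
    using N by (intro mult_left_mono) auto
  ultimately have "W z j \<le> 2 * sig * (real (z 0) + (\<Sum>i\<in>{1..K}. real (z i)) + real (m - ssum K z))"
    unfolding WW_def by (simp only: algebra_simps)
  also have "real (z 0) + (\<Sum>i\<in>{1..K}. real (z i)) + real (m - ssum K z) = real m"
    using assms ssum_split[of z] by (auto simp: EK_iff)
  finally show ?thesis .
qed

lemma Q_ge: "real m \<le> Q z"
  using sig by (simp add: total_fitness_def)

lemma Q_le:
  assumes "z \<in> E" shows "Q z \<le> sig * real m"
proof -
  have "(sig - 1) * real (z 0) \<le> (sig - 1) * real m"
    using sig EK_le[OF assms] by (intro mult_left_mono) auto
  then show ?thesis by (simp add: total_fitness_def algebra_simps)
qed

lemma D_eq: "D z = real m * Q z"
  by (simp add: DD_def total_fitness_def)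

lemma D_ge: "(real m)\<^sup>2 \<le> D z"
  using Q_ge[of z] by (simp add: D_eq power2_eq_square mult_left_mono)

lemma m_pos: "0 < real m" and Q_pos: "0 < Q z" and D_pos: "0 < D z"
proof -
  show *: "0 < real m" using m by simp
  then show "0 < Q z" using Q_ge[of z] by linarith
  with * show "0 < D z" by (simp add: D_eq)
qed

lemma birth_le:
  assumes "z \<in> E" "k \<le> K" shows "(real m - real (z k)) * W z k / D z \<le> 2 * sig"
proof -
  have "(real m - real (z k)) * W z k \<le> real m * (2 * sig * real m)"
    using assms W_le W_nonneg EK_le[OF assms(1)] sig by (intro mult_mono) auto
  also have "\<dots> \<le> 2 * sig * D z" using D_ge[of z] sig by (simp add: power2_eq_square)
  finally show ?thesis using D_pos[of z] by (simp add: divide_le_eq)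
qed

lemma death_le:
  assumes "z \<in> E" "k \<le> K" shows "real (z k) * (Q z - W z k) / D z \<le> real (z k) / real m"
proof -
  have "real (z k) * (Q z - W z k) / D z \<le> real (z k) * Q z / D z"
    using W_nonneg[OF assms(2), of z] D_pos[of z] by (intro divide_right_mono mult_left_mono) auto
  also have "\<dots> = real (z k) / real m" using Q_pos[of z] by (simp add: D_eq)
  finally show ?thesis .
qed

lemma jump_sum_bound:
  assumes z: "z \<in> E" and B: "\<And>y. (\<And>i. y i \<le> m + 1) \<Longrightarrow> \<bar>g y\<bar> \<le> B"
  shows "\<bar>jump_sum g z\<bar> \<le> (real K + 1) * (sig * (4 * real K + 7)) * B"
proof -
  have B0: "0 \<le> B" using B[of "\<lambda>_. 0"] by (smt (verit) le0)
  have zm: "z i \<le> m" for i using EK_le[OF z] .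
  have sm: "ssum K z \<le> m" using z by (simp add: EK_iff)
  have frac: "\<bar>real a * w / D z\<bar> \<le> c" if "a \<le> m" "\<bar>w\<bar> \<le> c * real m" "0 \<le> c" for a w c
  proof -
    have "\<bar>real a * w\<bar> \<le> real m * (c * real m)"
      unfolding abs_mult using that by (intro mult_mono) auto
    also have "\<dots> \<le> c * D z" using D_ge[of z] that(3) by (simp add: power2_eq_square mult_left_mono mult.left_commute)
    finally show ?thesis using D_pos[of z] by (simp add: divide_le_eq abs_mult)
  qed
  have W: "\<bar>W z j\<bar> \<le> 2 * sig * real m" if "j \<le> K" for j using W_le[OF z that] W_nonneg[OF that] by simp
  have SW: "\<bar>\<Sum>h\<le>K. W z h\<bar> \<le> (real K + 1) * (2 * sig * real m)"
    using sum_bounded_above[of "{..K}" "\<lambda>h. \<bar>W z h\<bar>" "2 * sig * real m"] W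
    by (intro order_trans[OF sum_abs]) (simp add: add.commute)
  have dQ: "\<bar>Q z - (\<Sum>h\<le>K. W z h)\<bar> \<le> sig * (2 * real K + 3) * real m"
    using SW Q_le[OF z] Q_pos[of z] by (simp add: algebra_simps)
  have tm: "\<bar>r * g y\<bar> \<le> c * B" if "\<bar>r\<bar> \<le> c" "\<And>i. y i \<le> m + 1" for r c y
    unfolding abs_mult using that B[of y] by (intro mult_mono) auto
  have "\<bar>jump_sum g z\<bar> \<le> (\<Sum>i\<le>K. sig * (4 * real K + 7) * B)"
    unfolding jump_sum_def
  proof (rule sum_abs[THEN order_trans], rule sum_mono)
    fix i assume "i \<in> {..K}"
    then have i: "i \<le> K" by simp
    have 1: "\<bar>up_rate i z * g (zplus i z)\<bar> \<le> (2 * sig) * B"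
      unfolding up_rate_def using zm W[OF i] sig by (intro tm frac) (auto simp: zplus_def le_SucI)
    have 2: "\<bar>down_rate i z * g (zminus i z)\<bar> \<le> (sig * (2 * real K + 3)) * B"
      unfolding down_rate_def using zm dQ sig
      by (intro tm frac) (auto simp: zminus_def le_SucI le_diff_conv)
    have "\<bar>\<Sum>j\<in>{..K}-{i}. move_rate i j z * g (zplus j (zminus i z))\<bar> \<le> (\<Sum>j\<in>{..K}-{i}. (2 * sig) * B)"
      by (rule sum_abs[THEN order_trans], rule sum_mono)
        (unfold move_rate_def, intro tm frac, use zm W sig in \<open>auto simp: zminus_def zplus_def le_SucI le_diff_conv\<close>)
    also have "\<dots> \<le> (\<Sum>j\<in>{..K}. (2 * sig) * B)"
      using B0 sig by (intro sum_mono2) auto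
    finally have 3: "\<bar>\<Sum>j\<in>{..K}-{i}. move_rate i j z * g (zplus j (zminus i z))\<bar> \<le> (real K + 1) * (2 * sig * B)"
      by (simp add: add.commute)
    have "(2 * sig) * B + (sig * (2 * real K + 3)) * B + (real K + 1) * (2 * sig * B) = sig * (4 * real K + 7) * B"
      by (simp add: algebra_simps)
    with 1 2 3 show "\<bar>up_rate i z * g (zplus i z) + down_rate i z * g (zminus i z) +
         (\<Sum>j\<in>{..K} - {i}. move_rate i j z * g (zplus j (zminus i z)))\<bar> \<le> sig * (4 * real K + 7) * B"
      by linarith
  qed
  then show ?thesis by (simp add: add.commute mult.assoc)
qed

lemma gen_bound:
  assumes z: "z \<in> E" and B: "\<And>y. (\<And>i. y i \<le> m + 1) \<Longrightarrow> \<bar>g y\<bar> \<le> B"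
  shows "\<bar>gen g z\<bar> \<le> ((real K + 1) * (sig * (4 * real K + 7)) + 1) * (2 * B)"
proof -
  have B0: "0 \<le> B" using B[of "\<lambda>_. 0"] by (smt (verit) le0)
  have gE: "\<bar>g y\<bar> \<le> B" if "y \<in> E" for y using B EK_le[OF that] by (simp add: le_SucI)
  let ?R = "(real K + 1) * (sig * (4 * real K + 7))"
  have R0: "0 \<le> ?R" using sig by simp
  show ?thesis
  proof (cases "z 0 = 0")
    case True
    have "\<bar>gen g z\<bar> \<le> 1 * (2 * B)" using gE[OF z] gE[OF zth_EK] by (simp add: gen_def P_sum_zero[of z g, OF True])
    also have "\<dots> \<le> (?R + 1) * (2 * B)" using R0 B0 by (intro mult_right_mono) auto
    finally show ?thesis .
  next
    case False
    have "\<bar>gen g z\<bar> \<le> ?R * (2 * B)"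
      unfolding gen_def P_sum[OF z False[unfolded neq0_conv]] add_diff_cancel_left'
    proof (rule jump_sum_bound[OF z])
      fix y :: "nat \<Rightarrow> nat" assume "\<And>i. y i \<le> m + 1"
      then have "\<bar>if z 0 = 1 \<and> y 0 = 0 then g (\<lambda>_. 0) else g y\<bar> \<le> B" using B[of y] B[of "\<lambda>_. 0"] by simp
      with gE[OF z] show "\<bar>(if z 0 = 1 \<and> y 0 = 0 then g (\<lambda>_. 0) else g y) - g z\<bar> \<le> 2 * B" by linarith
    qed
    also have "\<dots> \<le> (?R + 1) * (2 * B)" using B0 by (intro mult_right_mono) auto
    finally show ?thesis .
  qed
qed

lemma invariant_mass_small:
  assumes inv: "invariant_prob E P \<nu>"
    and lam: "0 < lam" "lam < 1" and del: "0 < del" and c: "0 < c" "c \<le> 1"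
    and growth: "(1 + c) * ((sig - 1) * del + 1) \<le> lam * sig * NT kap q K l th 0 0"
  shows "(\<Sum>z\<in>{z\<in>E. real (z 0) \<le> del * real m / 2}. \<nu> z) \<le> real m / c * lam powr (del * real m / 2 - 1)"
proof -
  let ?g = "\<lambda>y :: nat \<Rightarrow> nat. lam ^ y 0"
  let ?A = "{z\<in>E. real (z 0) \<le> del * real m / 2}"
  let ?e = "lam powr (del * real m - 1)" and ?r = "lam powr (del * real m / 2) * (c / real m)"
  have cm: "c / real m \<le> 1" using c m by (simp add: divide_le_eq)
  have pt: "gen ?g z \<le> (1 - lam) * (?e - (if z \<in> ?A then ?r else 0))" if z: "z \<in> E" for z
  proof (cases "z 0 = 0")
    case True
    have "zth K l m th 0 = 1" by (simp add: zth_def)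
    then have "gen ?g z = (1 - lam) * (-1)"
      unfolding gen_def P_sum_zero[of z ?g, OF True] using True by simp
    also have "lam powr (del * real m / 2) \<le> 1" using lam del by (intro powr_le1) auto
    then have "?r \<le> 1" using cm c m_pos lam by (intro mult_le_one) auto
    then have "(if z \<in> ?A then ?r else 0) \<le> 1" by (smt (verit))
    then have "(1 - lam) * (-1) \<le> (1 - lam) * (?e - (if z \<in> ?A then ?r else 0))"
      using lam powr_ge_zero[of lam "del * real m - 1"] by (intro mult_left_mono; linarith)
    finally show ?thesis .
  next
    case False
    then obtain i where i: "z 0 = Suc i" by (cases "z 0") auto
    let ?b = "(real m - real (z 0)) * W z 0 / D z" and ?d = "real (z 0) * (Q z - W z 0) / D z"
    have "gen ?g z = ?b * (lam ^ (z 0 + 1) - lam ^ z 0) + ?d * (lam ^ (z 0 - 1) - lam ^ z 0)"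
      using gen_coord[OF z, of 0 "\<lambda>i. lam ^ i"] False by simp
    also have "\<dots> = (1 - lam) * (lam ^ i * (?d - lam * ?b))"
    proof -
      have "b * (lam ^ (Suc i + 1) - lam ^ Suc i) + d * (lam ^ (Suc i - 1) - lam ^ Suc i)
        = (1 - lam) * (lam ^ i * (d - lam * b))" for b d by (simp add: algebra_simps)
      then show ?thesis unfolding i .
    qed
    finally have gen: "gen ?g z = (1 - lam) * (lam ^ i * (?d - lam * ?b))" .
    have zm: "real (z 0) \<le> real m" using EK_le[OF z, of 0] by simp
    have "?d - lam * ?b = real (z 0) * Q z / D z - (real (z 0) + lam * (real m - real (z 0))) * W z 0 / D z"
      by (simp add: algebra_simps add_divide_distrib diff_divide_distrib)
    also have "\<dots> \<le> real (z 0) * Q z / D z - (lam * real m) * W z 0 / D z"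
    proof -
      have "0 \<le> (1 - lam) * real (z 0)" using lam by simp
      then have "lam * real m \<le> real (z 0) + lam * (real m - real (z 0))" by (simp add: algebra_simps)
      then show ?thesis using W_nonneg[of 0 z] D_pos[of z]
        by (intro diff_left_mono divide_right_mono mult_right_mono) auto
    qed
    also have "\<dots> = real (z 0) / real m - lam * W z 0 / Q z"
      using Q_pos[of z] m_pos by (simp add: D_eq)
    finally have d1: "?d - lam * ?b \<le> real (z 0) / real m - lam * W z 0 / Q z" .
    have lamW: "0 \<le> lam * W z 0 / Q z" using lam W_nonneg[of 0 z] Q_pos[of z] by simp
    have "lam ^ i * (?d - lam * ?b) \<le> ?e - (if z \<in> ?A then ?r else 0)"
    proof (cases "real (z 0) \<le> del * real m")
      case True
      have Qle: "Q z \<le> ((sig - 1) * del + 1) * real m"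
        using mult_left_mono[OF True, of "sig - 1"] sig by (simp add: total_fitness_def algebra_simps)
      have "(1 + c) * real (z 0) * Q z \<le> (1 + c) * real (z 0) * (((sig - 1) * del + 1) * real m)"
        using Qle c by (intro mult_left_mono) auto
      also have "\<dots> = real (z 0) * real m * ((1 + c) * ((sig - 1) * del + 1))" by (simp add: mult_ac)
      also have "\<dots> \<le> real (z 0) * real m * (lam * sig * NT kap q K l th 0 0)"
        by (rule mult_left_mono[OF growth]) auto
      also have "\<dots> = real m * (lam * (sig * real (z 0) * NT kap q K l th 0 0))" by (simp add: mult_ac)
      also have "\<dots> \<le> real m * (lam * W z 0)" using W_ge[of 0 z] lam by (intro mult_left_mono) auto
      finally have "(1 + c) * real (z 0) / real m \<le> lam * W z 0 / Q z"
        using Q_pos[of z] m_pos by (simp add: divide_simps mult_ac)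
      with d1 have "?d - lam * ?b \<le> - (c * real (z 0) / real m)" by (simp add: add_divide_distrib distrib_right)
      also have "\<dots> \<le> - (c / real m)" using c i m_pos by (simp add: divide_right_mono)
      finally have "lam ^ i * (?d - lam * ?b) \<le> lam ^ i * (- (c / real m))" using lam by (intro mult_left_mono) auto
      also have "\<dots> \<le> - (if z \<in> ?A then ?r else 0)"
      proof (cases "z \<in> ?A")
        case True
        then have "real i \<le> del * real m / 2" using i by simp
        then have "lam powr (del * real m / 2) \<le> lam powr real i" using lam by (intro powr_mono') auto
        then have "lam powr (del * real m / 2) * (c / real m) \<le> lam ^ i * (c / real m)"
          using c m_pos lam by (intro mult_right_mono) (auto simp: powr_realpow)
        then show ?thesis using True by simp
      qed (use c lam in auto)
      finally show ?thesis using powr_ge_zero[of lam "del * real m - 1"] by linarith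
    next
      case False
      have zA: "z \<notin> ?A"
      proof
        assume "z \<in> ?A"
        then have "real (z 0) \<le> del * real m / 2" by simp
        moreover have "0 < del * real m" using del m_pos by simp
        ultimately show False using False by linarith
      qed
      have "?d - lam * ?b \<le> 1" using d1 lamW zm m_pos divide_le_eq_1_pos[of "real m" "real (z 0)"] by linarith
      then have "lam ^ i * (?d - lam * ?b) \<le> lam ^ i * 1" using lam by (intro mult_left_mono) auto
      also have "\<dots> = lam powr real i" using lam by (simp add: powr_realpow)
      also have "\<dots> \<le> ?e" using False i lam by (intro powr_mono') auto
      finally show ?thesis by (simp only: zA if_False diff_zero)
    qed
    then show ?thesis unfolding gen using lam by (intro mult_left_mono) auto
  qed
  have nu: "\<And>z. z \<in> E \<Longrightarrow> 0 \<le> \<nu> z" "(\<Sum>z\<in>E. \<nu> z) = 1" using inv by (auto simp: invariant_prob_def)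
  have "0 = (\<Sum>z\<in>E. \<nu> z * gen ?g z)" using sum_gen_invariant[OF inv] by simp
  also have "\<dots> \<le> (\<Sum>z\<in>E. \<nu> z * ((1 - lam) * (?e - (if z \<in> ?A then ?r else 0))))"
    using nu pt by (intro sum_mono mult_left_mono) auto
  also have "\<dots> = (1 - lam) * (\<Sum>z\<in>E. \<nu> z * ?e - (if z \<in> ?A then \<nu> z * ?r else 0))"
    unfolding sum_distrib_left by (intro sum.cong) (auto simp: algebra_simps)
  also have "(\<Sum>z\<in>E. \<nu> z * ?e - (if z \<in> ?A then \<nu> z * ?r else 0)) = ?e - (\<Sum>z\<in>?A. \<nu> z) * ?r"
  proof -
    have "(\<Sum>z\<in>E. if z \<in> ?A then \<nu> z * ?r else 0) = (\<Sum>z\<in>?A. \<nu> z * ?r)"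
      by (rule sum.mono_neutral_cong_right) (auto simp: finite_EK)
    then show ?thesis by (simp only: sum_subtractf sum_distrib_right[symmetric] nu(2) mult_1_left)
  qed
  finally have "(\<Sum>z\<in>?A. \<nu> z) * ?r \<le> ?e" using lam by (simp add: zero_le_mult_iff)
  also have "?e = lam powr (del * real m / 2) * lam powr (del * real m / 2 - 1)"
    by (simp flip: powr_add)
  finally have "lam powr (del * real m / 2) * ((\<Sum>z\<in>?A. \<nu> z) * (c / real m))
     \<le> lam powr (del * real m / 2) * lam powr (del * real m / 2 - 1)" by (simp add: mult_ac)
  then have "(\<Sum>z\<in>?A. \<nu> z) * (c / real m) \<le> lam powr (del * real m / 2 - 1)"
    using lam by (subst (asm) mult_le_cancel_left_pos) auto
  then show ?thesis using c m_pos by (simp add: field_simps)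
qed

lemma invariant_energy:
  assumes inv: "invariant_prob E P \<nu>" and k: "k \<le> K"
  shows "(\<Sum>z\<in>E. \<nu> z * ((real (z k) / real m - r) * (real (z k) / real m - W z k / Q z)))
     \<le> (2 * sig + 1) / real m + energy_const sig K r * (real m * (\<Sum>z\<in>{z\<in>E. z 0 \<le> 1}. \<nu> z))"
proof -
  let ?h = "\<lambda>i::nat. (real i / real m - r)\<^sup>2"
  let ?g = "\<lambda>y :: nat \<Rightarrow> nat. ?h (y k)"
  let ?G = "((real K + 1) * (sig * (4 * real K + 7)) + 1) * (2 * (2 + \<bar>r\<bar>)\<^sup>2)"
  have G0: "0 \<le> ?G" using sig by simp
  have m1: "1 \<le> real m" using m by simp
  have gb: "\<bar>gen ?g z\<bar> \<le> ?G" if "z \<in> E" for z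
  proof (rule gen_bound[OF that])
    fix y :: "nat \<Rightarrow> nat" assume "\<And>i. y i \<le> m + 1"
    then have "real (y k) \<le> real m + 1" by (metis of_nat_1 of_nat_add of_nat_le_iff)
    then have "real (y k) / real m \<le> 2" using m by (simp add: divide_le_eq)
    moreover have "0 \<le> real (y k) / real m" by simp
    ultimately have "\<bar>real (y k) / real m - r\<bar> \<le> 2 + \<bar>r\<bar>" by linarith
    then show "\<bar>?h (y k)\<bar> \<le> (2 + \<bar>r\<bar>)\<^sup>2" by (simp add: abs_le_square_iff[symmetric])
  qed
  have pt: "(real (z k) / real m - r) * (real (z k) / real m - W z k / Q z)
     \<le> - (real m / 2) * gen ?g z + (2 * sig + 1) / real m
        + (if z \<in> {z\<in>E. z 0 \<le> 1} then energy_const sig K r * real m else 0)" if z: "z \<in> E" for z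
  proof -
    define x where "x = real (z k) / real m"
    have x: "0 \<le> x" "x \<le> 1" using EK_le[OF z, of k] m_pos by (auto simp: x_def)
    have V: "0 \<le> W z k / Q z" "W z k / Q z \<le> 2 * sig"
    proof -
      have "W z k \<le> 2 * sig * Q z" using W_le[OF z k] Q_ge[of z] sig
        by (meson mult_left_mono order_trans less_imp_le zero_le_mult_iff zero_le_numeral zero_less_one less_trans)
      then show "W z k / Q z \<le> 2 * sig" using Q_pos[of z] by (simp add: divide_le_eq)
      show "0 \<le> W z k / Q z" using W_nonneg[OF k] Q_pos[of z] by simp
    qed
    show ?thesis
    proof (cases "z 0 \<le> 1")
      case True
      have "\<bar>(x - r) * (x - W z k / Q z)\<bar> \<le> (1 + \<bar>r\<bar>) * (1 + 2 * sig)"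
        unfolding abs_mult using x V by (intro mult_mono) auto
      also have "\<dots> \<le> (1 + \<bar>r\<bar>) * (1 + 2 * sig) * real m"
        using mult_left_mono[OF m1, of "(1 + \<bar>r\<bar>) * (1 + 2 * sig)"] sig by simp
      moreover have "real m / 2 * gen ?g z \<le> real m * ?G"
      proof -
        have "real m / 2 * gen ?g z \<le> real m / 2 * ?G" using gb[OF z] by (intro mult_left_mono) auto
        also have "\<dots> \<le> real m * ?G" using G0 by (intro mult_right_mono) auto
        finally show ?thesis .
      qed
      moreover have "0 \<le> (2 * sig + 1) / real m" using sig by simp
      moreover have "energy_const sig K r * real m = real m * ?G + (1 + \<bar>r\<bar>) * (1 + 2 * sig) * real m"
        by (simp add: energy_const_def algebra_simps)
      ultimately show ?thesis using z True unfolding x_def by (auto simp: abs_le_iff)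
    next
      case False
      let ?b = "(real m - real (z k)) * W z k / D z" and ?d = "real (z k) * (Q z - W z k) / D z"
      have "gen ?g z = ?b * (?h (z k + 1) - ?h (z k)) + ?d * (?h (z k - 1) - ?h (z k))"
        using False by (intro gen_coord[OF z k]) auto
      also have "?h (z k + 1) - ?h (z k) = 2 * (x - r) / real m + 1 / (real m)\<^sup>2"
        using m_pos by (simp add: x_def power2_eq_square field_simps)
      also have "?d * (?h (z k - 1) - ?h (z k)) = ?d * (- 2 * (x - r) / real m + 1 / (real m)\<^sup>2)"
      proof (cases "z k = 0")
        case False
        then have "real (z k - 1) = real (z k) - 1" by simp
        then have "?h (z k - 1) - ?h (z k) = - 2 * (x - r) / real m + 1 / (real m)\<^sup>2"
          using m_pos by (simp add: x_def power2_eq_square field_simps)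
        then show ?thesis by simp
      qed simp
      finally have gz: "gen ?g z = (?b - ?d) * (2 * (x - r) / real m) + (?b + ?d) * (1 / (real m)\<^sup>2)"
        by (simp only: distrib_left distrib_right left_diff_distrib)
      have bd: "?b - ?d = W z k / Q z - x"
      proof -
        have "?b - ?d = (real m * W z k - real (z k) * Q z) / (real m * Q z)"
          unfolding diff_divide_distrib[symmetric] D_eq by (simp add: algebra_simps)
        then show ?thesis using m_pos Q_pos[of z] by (simp add: x_def diff_divide_distrib)
      qed
      have "real m / 2 * gen ?g z = (W z k / Q z - x) * (x - r) + (?b + ?d) / (2 * real m)"
      proof -
        have "real m / 2 * (v * (2 * (x - r) / real m) + s * (1 / (real m)\<^sup>2)) = v * (x - r) + s / (2 * real m)" for v s
          using m_pos by (simp add: field_simps power2_eq_square)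
        then show ?thesis unfolding gz bd .
      qed
      moreover have "(?b + ?d) / (2 * real m) \<le> (2 * sig + 1) / real m"
      proof -
        have "?b + ?d \<le> 2 * sig + 1" using birth_le[OF z k] death_le[OF z k] x by (simp add: x_def)
        then have "(?b + ?d) / (2 * real m) \<le> (2 * sig + 1) / (2 * real m)" by (intro divide_right_mono) auto
        also have "\<dots> \<le> (2 * sig + 1) / real m" using sig m_pos by (intro divide_left_mono) auto
        finally show ?thesis .
      qed
      moreover have "(x - r) * (x - W z k / Q z) = - ((W z k / Q z - x) * (x - r))" by (simp add: algebra_simps)
      moreover have "z \<notin> {z\<in>E. z 0 \<le> 1}" using False by simp
      ultimately show ?thesis unfolding x_def[symmetric] by (simp only: if_False mult_minus_left)
    qed
  qed
  have nu: "\<And>z. z \<in> E \<Longrightarrow> 0 \<le> \<nu> z" "(\<Sum>z\<in>E. \<nu> z) = 1" using inv by (auto simp: invariant_prob_def)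
  have "(\<Sum>z\<in>E. \<nu> z * ((real (z k) / real m - r) * (real (z k) / real m - W z k / Q z)))
    \<le> (\<Sum>z\<in>E. \<nu> z * (- (real m / 2) * gen ?g z + (2 * sig + 1) / real m
        + (if z \<in> {z\<in>E. z 0 \<le> 1} then energy_const sig K r * real m else 0)))"
    using pt nu by (intro sum_mono mult_left_mono) auto
  also have "\<dots> = - (real m / 2) * (\<Sum>z\<in>E. \<nu> z * gen ?g z) + (\<Sum>z\<in>E. \<nu> z) * ((2 * sig + 1) / real m)
      + (\<Sum>z\<in>E. if z \<in> {z\<in>E. z 0 \<le> 1} then \<nu> z * (energy_const sig K r * real m) else 0)"
    unfolding sum_distrib_left sum_distrib_right sum.distrib[symmetric]
    by (intro sum.cong) (auto simp: algebra_simps)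
  also have "(\<Sum>z\<in>E. if z \<in> {z\<in>E. z 0 \<le> 1} then \<nu> z * (energy_const sig K r * real m) else 0)
     = (\<Sum>z\<in>{z\<in>E. z 0 \<le> 1}. \<nu> z * (energy_const sig K r * real m))"
    by (rule sum.mono_neutral_cong_right) (auto simp: finite_EK)
  also have "\<dots> = energy_const sig K r * (real m * (\<Sum>z\<in>{z\<in>E. z 0 \<le> 1}. \<nu> z))"
    by (simp add: sum_distrib_left mult_ac)
  finally show ?thesis by (simp add: sum_gen_invariant[OF inv] nu(2))
qed

end

section \<open>The asymptotic regime\<close>

lemma tendsto_zero_squeeze:
  fixes f :: "'a \<Rightarrow> real"
  assumes "\<And>n. 0 \<le> f n" "\<forall>\<^sub>F n in F. f n \<le> g n" "(g \<longlongrightarrow> 0) F"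
  shows "(f \<longlongrightarrow> 0) F"
  by (rule tendsto_sandwich[OF always_eventually assms(2) tendsto_const assms(3)]) (use assms(1) in blast)

lemma NT_beyond: "K < b \<Longrightarrow> NT kap q K l th b c = NT kap q K l th (K + 1) c"
  by (simp add: NT_def)

lemma poisson_mutation_bounds:
  assumes "0 < a" shows "0 \<le> poisson_mutation a b c" "poisson_mutation a b c \<le> 1"
proof -
  have "a ^ k / fact k \<le> exp a" for k
    using sum_le_suminf[OF summable_exp_generic[of a], of "{k}"] assms
    by (simp add: exp_def scaleR_conv_of_real divide_inverse mult.commute)
  then have "exp (- a) * (a ^ k / fact k) \<le> exp (- a) * exp a" for k by (intro mult_left_mono) auto
  then show "poisson_mutation a b c \<le> 1" by (auto simp: poisson_mutation_def exp_minus)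
  show "0 \<le> poisson_mutation a b c" using assms by (auto simp: poisson_mutation_def)
qed

locale mutation_regime =
  fixes kap K :: nat and sig a :: real
    and l m :: "nat \<Rightarrow> nat" and q :: "nat \<Rightarrow> real"
    and upper :: bool
    and \<nu> :: "nat \<Rightarrow> (nat \<Rightarrow> nat) \<Rightarrow> real"
  assumes kap: "kap \<ge> 2" and sig: "sig > 1"
    and l_ge: "\<And>n. l n \<ge> K + 2" and m_ge: "\<And>n. m n \<ge> 2"
    and q_pos: "\<And>n. 0 < q n" and q_lt: "\<And>n. q n < 1 - 1 / real kap"
    and l_lim: "filterlim l at_top sequentially"
    and m_lim: "filterlim m at_top sequentially"
    and q_lim: "q \<longlonglongrightarrow> 0"
    and a_pos: "0 < a"
    and lq_lim: "(\<lambda>n. real (l n) * q n) \<longlonglongrightarrow> a"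
    and sig_a: "sig * exp (- a) > 1"
    and inv: "\<And>n. invariant_prob (EK K (m n))
                 (pth kap sig K (l n) (m n) (q n) (if upper then l n else K + 1)) (\<nu> n)"
begin

definition th :: "nat \<Rightarrow> nat" where
  "th n = (if upper then l n else K + 1)"

abbreviation N :: "nat \<Rightarrow> nat \<Rightarrow> nat \<Rightarrow> real" where
  "N n b c \<equiv> NT kap (q n) K (l n) (th n) b c"

definition Nlim :: "nat \<Rightarrow> nat \<Rightarrow> real" where
  "Nlim b c = (if b \<le> K then poisson_mutation a b c else 0)"

definition ex :: "nat \<Rightarrow> ((nat \<Rightarrow> nat) \<Rightarrow> real) \<Rightarrow> real" where
  "ex n g = (\<Sum>z\<in>EK K (m n). \<nu> n z * g z)"

abbreviation x :: "nat \<Rightarrow> (nat \<Rightarrow> nat) \<Rightarrow> nat \<Rightarrow> real" where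
  "x n z k \<equiv> real (z k) / real (m n)"

abbreviation ratio :: "nat \<Rightarrow> (nat \<Rightarrow> nat) \<Rightarrow> nat \<Rightarrow> real" where
  "ratio n z k \<equiv> WW kap sig K (l n) (m n) (q n) (th n) z k / total_fitness sig (m n) z"

abbreviation rho :: "nat \<Rightarrow> real" where
  "rho k \<equiv> rho_star sig a k"

lemma th_gt: "K < th n"
  using l_ge[of n] by (simp add: th_def)

lemma invariant: "invariant_prob (EK K (m n)) (pth kap sig K (l n) (m n) (q n) (th n)) (\<nu> n)"
  using inv unfolding th_def .

lemma nu_nonneg: "z \<in> EK K (m n) \<Longrightarrow> 0 \<le> \<nu> n z"
  and nu_sum: "(\<Sum>z\<in>EK K (m n). \<nu> n z) = 1"
  using invariant[of n] by (auto simp: invariant_prob_def)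

lemma ex_mono: "(\<And>z. z \<in> EK K (m n) \<Longrightarrow> g z \<le> h z) \<Longrightarrow> ex n g \<le> ex n h"
  unfolding ex_def by (intro sum_mono mult_left_mono nu_nonneg)

lemma ex_nonneg: "(\<And>z. z \<in> EK K (m n) \<Longrightarrow> 0 \<le> g z) \<Longrightarrow> 0 \<le> ex n g"
  unfolding ex_def by (intro sum_nonneg mult_nonneg_nonneg nu_nonneg)

lemma ex_add: "ex n (\<lambda>z. g z + h z) = ex n g + ex n h"
  by (simp add: ex_def distrib_left sum.distrib)

lemma ex_cmult: "ex n (\<lambda>z. c * g z) = c * ex n g"
  by (simp add: ex_def sum_distrib_left mult_ac)

lemma ex_const: "ex n (\<lambda>z. c) = c"
  by (simp add: ex_def nu_sum flip: sum_distrib_right)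

lemma ex_sum: "ex n (\<lambda>z. \<Sum>i\<in>I. g i z) = (\<Sum>i\<in>I. ex n (g i))"
  by (simp add: ex_def sum_distrib_left) (rule sum.swap)

lemma ex_indicator: "ex n (\<lambda>z. if R z then 1 else 0) = (\<Sum>z\<in>{z\<in>EK K (m n). R z}. \<nu> n z)"
  unfolding ex_def by (rule sum.mono_neutral_cong_right) (auto simp: finite_EK)

lemma m_pos: "0 < real (m n)"
  using m_ge[of n] by simp

lemma x_bounds: "z \<in> EK K (m n) \<Longrightarrow> 0 \<le> x n z k" "z \<in> EK K (m n) \<Longrightarrow> x n z k \<le> 1"
  using EK_le[of z K "m n" k] m_pos[of n] by auto

lemma real_m_lim: "filterlim (\<lambda>n. real (m n)) at_top sequentially"
  using filterlim_compose[OF filterlim_real_sequentially m_lim] .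

lemma N_tendsto: "(\<lambda>n. N n b c) \<longlonglongrightarrow> Nlim b c"
proof -
  have q1: "q n < 1" for n using q_lt[of n] by (smt (verit) divide_nonneg_nonneg of_nat_0_le_iff)
  note MH = MH_tendsto[OF kap l_lim q_lim q_pos q1 lq_lim]
  have th: "th n = l n \<longleftrightarrow> upper" for n using l_ge[of n] by (auto simp: th_def)
  show ?thesis
  proof (cases "b \<le> c \<and> b \<le> K")
    case True
    then show ?thesis using MH[of b c] by (simp add: NT_def Nlim_def)
  next
    case False
    then have "Nlim b c = poisson_mutation a (c + 1) c" by (auto simp: Nlim_def poisson_mutation_def)
    moreover have "poisson_mutation a (c + 1) c = 0" by (simp add: poisson_mutation_def)
    moreover have "N n b c = (if upper then 0 else MH kap (l n) (q n) (c + 1) c)" for n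
      using False th[of n] by (auto simp: NT_def)
    ultimately show ?thesis using MH[of "c + 1" c] by (cases upper) simp_all
  qed
qed

lemma N_nonneg: "0 \<le> N n b c"
  using MH_nonneg[OF kap q_pos q_lt] by (simp add: NT_def)

definition err :: "nat \<Rightarrow> real" where
  "err n = (\<Sum>b\<le>K + 1. \<Sum>c\<le>K. \<bar>N n b c - Nlim b c\<bar>)"

lemma err_tendsto: "err \<longlonglongrightarrow> 0"
proof -
  have "(\<lambda>n. \<Sum>b\<le>K + 1. \<Sum>c\<le>K. \<bar>N n b c - Nlim b c\<bar>) \<longlonglongrightarrow> (\<Sum>b\<le>K + 1. \<Sum>c\<le>K. \<bar>Nlim b c - Nlim b c\<bar>)"
    by (intro tendsto_intros N_tendsto)
  then show ?thesis by (simp add: err_def[abs_def])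
qed

lemma sum_diff_le_err: "c \<le> K \<Longrightarrow> (\<Sum>b\<le>K + 1. \<bar>N n b c - Nlim b c\<bar>) \<le> err n"
  unfolding err_def by (intro sum_mono member_le_sum) auto

lemma Nlim_bounds: "0 \<le> Nlim b c" "Nlim b c \<le> 1"
  using poisson_mutation_bounds[OF a_pos] by (auto simp: Nlim_def)

lemma eventually_chain: "\<forall>\<^sub>F n in sequentially. lumped_chain kap sig K (l n) (m n) (q n) (th n)"
proof -
  have "\<forall>\<^sub>F n in sequentially. \<forall>b\<in>{..K+1}. \<forall>c\<in>{..K}. N n b c < 2"
  proof (intro eventually_ball_finite ballI finite_atMost)
    fix b c
    have "Nlim b c < 2" using Nlim_bounds(2)[of b c] by linarith
    with N_tendsto show "\<forall>\<^sub>F n in sequentially. N n b c < 2" by (rule order_tendstoD(2))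
  qed
  then show ?thesis
  proof eventually_elim
    case (elim n)
    have "N n b c \<le> 2" if "c \<le> K" for b c
      using elim that NT_beyond[of K b kap "q n" "l n" "th n" c] by (cases "b \<le> K") (force intro: less_imp_le)+
    then show ?case using sig m_ge N_nonneg by (unfold_locales) auto
  qed
qed

lemma small_mass:
  obtains del where "0 < del"
    "(\<lambda>n. real (m n) * ex n (\<lambda>z. if real (z 0) \<le> del * real (m n) / 2 then 1 else 0)) \<longlonglongrightarrow> 0"
proof -
  define s where "s = sig * exp (- a)"
  define t where "t = (s + 1) / 2"
  define lam where "lam = t / s"
  define del where "del = (t - 1) / 2 / (sig - 1)"
  define c where "c = (t - 1) / (2 * (t + 1))"
  have s: "1 < s" using sig_a by (simp add: s_def)
  have t: "1 < t" "t < s" using s by (auto simp: t_def)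
  have lam: "0 < lam" "lam < 1" using s t by (auto simp: lam_def)
  have del: "0 < del" using t sig by (simp add: del_def)
  have c: "0 < c" "c \<le> 1" using t by (auto simp: c_def divide_le_eq)
  have cancel: "v * ((t - 1) / 2 / v) = (t - 1) / 2" if "v \<noteq> 0" for v using that by simp
  have e: "(sig - 1) * del = (t - 1) / 2" unfolding del_def using sig by (intro cancel) simp
  have "(1 + c) * ((sig - 1) * del + 1) = (3 * t + 1) / 4"
    unfolding e c_def using t by (simp add: field_simps)
  then have g: "(1 + c) * ((sig - 1) * del + 1) < t" using t by simp
  have "(\<lambda>n. lam * sig * N n 0 0) \<longlonglongrightarrow> lam * sig * Nlim 0 0" by (intro tendsto_intros N_tendsto)
  also have "lam * sig * Nlim 0 0 = lam * s" by (simp add: Nlim_def poisson_mutation_def s_def)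
  also have "lam * s = t" using s by (simp add: lam_def)
  finally have ev: "\<forall>\<^sub>F n in sequentially. (1 + c) * ((sig - 1) * del + 1) < lam * sig * N n 0 0"
    using g by (rule order_tendstoD(1))
  let ?p = "\<lambda>n. ex n (\<lambda>z. if real (z 0) \<le> del * real (m n) / 2 then 1 else 0)"
  have "\<forall>\<^sub>F n in sequentially. ?p n \<le> real (m n) / c * lam powr (del * real (m n) / 2 - 1)"
    using ev eventually_chain
  proof eventually_elim
    case (elim n)
    then interpret lumped_chain kap sig K "l n" "m n" "q n" "th n" by simp
    show ?case unfolding ex_indicator
      by (rule invariant_mass_small[OF invariant lam del c]) (use elim in simp)
  qed
  then have le: "\<forall>\<^sub>F n in sequentially. real (m n) * ?p n \<le> real (m n) * (real (m n) / c * lam powr (del * real (m n) / 2 - 1))"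
    by eventually_elim (intro mult_left_mono, auto)
  define b where "b = - ln lam * del / 2"
  have b: "0 < b" using lam del by (auto simp: b_def mult_neg_pos)
  have "((\<lambda>y::real. y\<^sup>2 / exp y) \<longlongrightarrow> 0) at_top" by (rule tendsto_power_div_exp_0)
  moreover have "filterlim (\<lambda>n. b * real (m n)) at_top sequentially"
    using filterlim_tendsto_pos_mult_at_top[OF tendsto_const b real_m_lim] .
  ultimately have "(\<lambda>n. (b * real (m n))\<^sup>2 / exp (b * real (m n))) \<longlonglongrightarrow> 0" by (rule filterlim_compose)
  then have "(\<lambda>n. 1 / (b\<^sup>2 * c * lam) * ((b * real (m n))\<^sup>2 / exp (b * real (m n)))) \<longlonglongrightarrow> 1 / (b\<^sup>2 * c * lam) * 0"
    by (intro tendsto_intros)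
  moreover have "1 / (b\<^sup>2 * c * lam) * ((b * real (m n))\<^sup>2 / exp (b * real (m n)))
     = real (m n) * (real (m n) / c * lam powr (del * real (m n) / 2 - 1))" for n
  proof -
    have "lam powr (del * real (m n) / 2 - 1) = lam powr (del * real (m n) / 2) / lam"
      using lam by (simp add: powr_diff)
    also have "lam powr (del * real (m n) / 2) = exp (- (b * real (m n)))"
      using lam by (simp add: powr_def b_def)
    finally show ?thesis using b by (simp add: exp_minus power2_eq_square field_simps)
  qed
  ultimately have lim: "(\<lambda>n. real (m n) * (real (m n) / c * lam powr (del * real (m n) / 2 - 1))) \<longlonglongrightarrow> 0" by simp
  have "(\<lambda>n. real (m n) * ?p n) \<longlonglongrightarrow> 0"
    by (rule tendsto_zero_squeeze[OF _ le lim]) (auto intro!: mult_nonneg_nonneg ex_nonneg)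
  with del that show ?thesis by blast
qed

lemma tendsto_zero_of_m_times:
  assumes "(\<lambda>n. real (m n) * p n) \<longlonglongrightarrow> 0" shows "p \<longlonglongrightarrow> 0"
proof -
  have "(\<lambda>n. (real (m n) * p n) * inverse (real (m n))) \<longlonglongrightarrow> 0 * 0"
    by (intro tendsto_mult assms tendsto_inverse_0_at_top real_m_lim)
  moreover have "(real (m n) * p n) * inverse (real (m n)) = p n" for n using m_pos[of n] by simp
  ultimately show ?thesis by simp
qed

lemma energy_tendsto:
  assumes k: "k \<le> K"
  obtains e where "e \<longlonglongrightarrow> 0" "\<forall>\<^sub>F n in sequentially. ex n (\<lambda>z. (x n z k - r) * (x n z k - ratio n z k)) \<le> e n"
proof -
  obtain del where del: "0 < del" and
    lim: "(\<lambda>n. real (m n) * ex n (\<lambda>z. if real (z 0) \<le> del * real (m n) / 2 then 1 else 0)) \<longlonglongrightarrow> 0"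
    by (rule small_mass)
  let ?p = "\<lambda>n. ex n (\<lambda>z. if real (z 0) \<le> del * real (m n) / 2 then 1 else 0)"
  let ?e = "\<lambda>n. (2 * sig + 1) * inverse (real (m n)) + \<bar>energy_const sig K r\<bar> * (real (m n) * ?p n)"
  have "?e \<longlonglongrightarrow> (2 * sig + 1) * 0 + \<bar>energy_const sig K r\<bar> * 0"
    by (intro tendsto_intros lim tendsto_inverse_0_at_top real_m_lim)
  moreover have "\<forall>\<^sub>F n in sequentially. 2 / del \<le> real (m n)"
    using real_m_lim by (simp add: filterlim_at_top)
  then have "\<forall>\<^sub>F n in sequentially. ex n (\<lambda>z. (x n z k - r) * (x n z k - ratio n z k)) \<le> ?e n"
    using eventually_chain
  proof eventually_elim
    case (elim n)
    then interpret lumped_chain kap sig K "l n" "m n" "q n" "th n" by simp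
    let ?o = "\<Sum>z\<in>{z\<in>EK K (m n). z 0 \<le> 1}. \<nu> n z"
    have dm: "1 \<le> del * real (m n) / 2" using elim(1) del by (simp add: field_simps)
    have "?o \<le> ?p n" unfolding ex_indicator[symmetric]
    proof (rule ex_mono)
      fix z :: "nat \<Rightarrow> nat"
      show "(if z 0 \<le> 1 then 1 else 0 :: real) \<le> (if real (z 0) \<le> del * real (m n) / 2 then 1 else 0)"
        using dm by auto
    qed
    moreover have "0 \<le> ?o" by (auto intro!: sum_nonneg nu_nonneg)
    ultimately have "energy_const sig K r * (real (m n) * ?o) \<le> \<bar>energy_const sig K r\<bar> * (real (m n) * ?p n)"
      by (intro mult_mono) auto
    moreover have "ex n (\<lambda>z. (x n z k - r) * (x n z k - ratio n z k)) \<le> (2 * sig + 1) / real (m n) + energy_const sig K r * (real (m n) * ?o)"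
      unfolding ex_def by (rule invariant_energy[OF invariant k])
    moreover have "(2 * sig + 1) / real (m n) = (2 * sig + 1) * inverse (real (m n))" by (rule divide_inverse)
    ultimately show ?case by linarith
  qed
  ultimately show ?thesis using that[of ?e] by simp
qed

definition w :: "nat \<Rightarrow> (nat \<Rightarrow> nat) \<Rightarrow> nat \<Rightarrow> real" where
  "w n z k = sig * x n z 0 * Nlim 0 k + (\<Sum>i\<in>{1..K}. x n z i * Nlim i k)"

definition X :: "nat \<Rightarrow> (nat \<Rightarrow> nat) \<Rightarrow> real" where
  "X n z = (sig - 1) * x n z 0 + 1"

lemma X_bounds:
  assumes "z \<in> EK K (m n)" shows "1 \<le> X n z" "X n z \<le> sig"
proof -
  show "1 \<le> X n z" using sig by (simp add: X_def)
  have "(sig - 1) * x n z 0 \<le> (sig - 1) * 1" using x_bounds[OF assms] sig by (intro mult_left_mono) auto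
  then show "X n z \<le> sig" by (simp add: X_def)
qed

lemma divide_X_le:
  assumes "z \<in> EK K (m n)" shows "\<bar>u / X n z\<bar> \<le> \<bar>u\<bar>"
proof -
  have "\<bar>u\<bar> * 1 \<le> \<bar>u\<bar> * X n z" using X_bounds[OF assms] by (intro mult_left_mono) auto
  then show ?thesis using X_bounds[OF assms] by (simp add: divide_le_eq)
qed

lemma ratio_approx:
  assumes z: "z \<in> EK K (m n)" and k: "k \<le> K"
  obtains d where "ratio n z k = (w n z k + d) / X n z" "\<bar>d\<bar> \<le> sig * err n"
proof
  define W where "W = WW kap sig K (l n) (m n) (q n) (th n) z k"
  have "total_fitness sig (m n) z = real (m n) * X n z"
    using m_pos[of n] by (simp add: total_fitness_def X_def field_simps)
  then show "ratio n z k = (w n z k + (W / real (m n) - w n z k)) / X n z" using m_pos[of n] by (simp add: W_def)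
  define y where "y = real (m n - ssum K z) / real (m n)"
  have y: "0 \<le> y" "y \<le> 1" using m_pos[of n] by (auto simp: y_def)
  let ?D = "\<lambda>b. N n b k - Nlim b k"
  have "W / real (m n) = sig * x n z 0 * N n 0 k + (\<Sum>i\<in>{1..K}. x n z i * N n i k) + y * N n (th n) k"
    by (simp add: W_def WW_def y_def add_divide_distrib sum_divide_distrib)
  also have "N n (th n) k = ?D (K + 1)" using NT_beyond[OF th_gt] by (simp add: Nlim_def)
  finally have eq: "W / real (m n) - w n z k = sig * x n z 0 * ?D 0 + (\<Sum>i\<in>{1..K}. x n z i * ?D i) + y * ?D (K + 1)"
    by (simp add: w_def right_diff_distrib sum_subtractf)
  have "\<bar>W / real (m n) - w n z k\<bar> \<le> sig * \<bar>?D 0\<bar> + (\<Sum>i\<in>{1..K}. sig * \<bar>?D i\<bar>) + sig * \<bar>?D (K + 1)\<bar>"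
  proof -
    have 1: "\<bar>u * ?D b\<bar> \<le> sig * \<bar>?D b\<bar>" if "0 \<le> u" "u \<le> sig" for u b
      unfolding abs_mult using that by (intro mult_right_mono) auto
    have x1: "x n z i \<le> sig" "sig * x n z i \<le> sig" for i
      using x_bounds[OF z, of i] sig mult_left_mono[of "x n z i" 1 sig] by auto
    have "\<bar>\<Sum>i\<in>{1..K}. x n z i * ?D i\<bar> \<le> (\<Sum>i\<in>{1..K}. sig * \<bar>?D i\<bar>)"
      using x_bounds[OF z] x1 by (intro order_trans[OF sum_abs] sum_mono 1) auto
    moreover have "\<bar>sig * x n z 0 * ?D 0\<bar> \<le> sig * \<bar>?D 0\<bar>" using x_bounds[OF z] x1 sig by (intro 1) auto
    moreover have "\<bar>y * ?D (K + 1)\<bar> \<le> sig * \<bar>?D (K + 1)\<bar>" using y sig by (intro 1) auto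
    ultimately show ?thesis unfolding eq by linarith
  qed
  also have "\<dots> = sig * (\<Sum>b\<le>K + 1. \<bar>?D b\<bar>)"
  proof -
    have "{..K + 1} = insert 0 (insert (K + 1) {1..K})" by auto
    then have "(\<Sum>b\<le>K + 1. \<bar>?D b\<bar>) = \<bar>?D 0\<bar> + (\<bar>?D (K + 1)\<bar> + (\<Sum>i\<in>{1..K}. \<bar>?D i\<bar>))" by simp
    then show ?thesis by (simp only: distrib_left sum_distrib_left add_ac)
  qed
  also have "\<dots> \<le> sig * err n" using sum_diff_le_err[OF k] sig by (intro mult_left_mono) auto
  finally show "\<bar>W / real (m n) - w n z k\<bar> \<le> sig * err n" .
qed

abbreviation dev :: "nat \<Rightarrow> (nat \<Rightarrow> nat) \<Rightarrow> nat \<Rightarrow> real" where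
  "dev n z k \<equiv> x n z k - rho k"

lemma dev_bound: "z \<in> EK K (m n) \<Longrightarrow> \<bar>dev n z k\<bar> \<le> 1 + \<bar>rho k\<bar>"
  using x_bounds[of z n k] by linarith

lemma second_moment_zero: "(\<lambda>n. ex n (\<lambda>z. (dev n z 0)\<^sup>2)) \<longlonglongrightarrow> 0"
proof -
  obtain del where del: "0 < del" and
    lim: "(\<lambda>n. real (m n) * ex n (\<lambda>z. if real (z 0) \<le> del * real (m n) / 2 then 1 else 0)) \<longlonglongrightarrow> 0"
    by (rule small_mass)
  let ?i = "\<lambda>n z. if real (z 0) \<le> del * real (m n) / 2 then 1 else 0"
  let ?p = "\<lambda>n. ex n (?i n)"
  obtain e where e: "e \<longlonglongrightarrow> 0"
    "\<forall>\<^sub>F n in sequentially. ex n (\<lambda>z. dev n z 0 * (x n z 0 - ratio n z 0)) \<le> e n"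
    by (rule energy_tendsto[of 0 "rho 0"]) auto
  define c where "c = del / 2 * (sig - 1) / sig"
  have c: "0 < c" using del sig by (simp add: c_def)
  define B where "B = 1 + \<bar>rho 0\<bar>"
  have pt: "c * (dev n z 0)\<^sup>2 \<le> dev n z 0 * (x n z 0 - ratio n z 0) + (c * B\<^sup>2) * ?i n z + B * (sig * err n)"
    if z: "z \<in> EK K (m n)" for n z
  proof -
    obtain d where d: "ratio n z 0 = (w n z 0 + d) / X n z" "\<bar>d\<bar> \<le> sig * err n"
      using ratio_approx[OF z, of 0] by auto
    have X: "1 \<le> X n z" "X n z \<le> sig" using X_bounds[OF z] .
    have w: "w n z 0 = sig * exp (- a) * x n z 0"
      by (simp add: w_def Nlim_def poisson_mutation_def)
    have rho0: "(sig - 1) * rho 0 = sig * exp (- a) - 1" using sig by (simp add: rho_star_zero)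
    have "X n z * x n z 0 - w n z 0 = x n z 0 * ((sig - 1) * x n z 0 - (sig * exp (- a) - 1))"
      unfolding X_def w by (simp only: algebra_simps)
    also have "\<dots> = x n z 0 * ((sig - 1) * dev n z 0)" unfolding rho0[symmetric] by (simp only: right_diff_distrib)
    finally have num: "X n z * x n z 0 - w n z 0 = x n z 0 * ((sig - 1) * dev n z 0)" .
    have "x n z 0 - ratio n z 0 = (X n z * x n z 0 - w n z 0 - d) / X n z" using X unfolding d(1) by (simp add: field_simps)
    have eq: "dev n z 0 * (x n z 0 - ratio n z 0) = x n z 0 * (sig - 1) / X n z * (dev n z 0)\<^sup>2 - dev n z 0 * d / X n z"
    proof -
      have "v * ((y * ((sig - 1) * v) - d) / X n z) = y * (sig - 1) / X n z * v\<^sup>2 - v * d / X n z" for v y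
        by (simp add: power2_eq_square diff_divide_distrib right_diff_distrib mult_ac)
      then show ?thesis unfolding \<open>x n z 0 - ratio n z 0 = _\<close> num .
    qed
    have "\<bar>dev n z 0 * d / X n z\<bar> \<le> \<bar>dev n z 0 * d\<bar>"
      by (rule divide_X_le[OF z])
    also have "\<dots> \<le> B * (sig * err n)"
      unfolding abs_mult B_def using dev_bound[OF z] d(2) by (intro mult_mono) auto
    finally have rem: "dev n z 0 * d / X n z \<le> B * (sig * err n)" by linarith
    have "c * (dev n z 0)\<^sup>2 \<le> x n z 0 * (sig - 1) / X n z * (dev n z 0)\<^sup>2 + (c * B\<^sup>2) * ?i n z"
    proof (cases "real (z 0) \<le> del * real (m n) / 2")
      case True
      have "(dev n z 0)\<^sup>2 \<le> B\<^sup>2" unfolding B_def using dev_bound[OF z, of 0] by (simp add: abs_le_square_iff[symmetric])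
      then have "c * (dev n z 0)\<^sup>2 \<le> c * B\<^sup>2" using c by (intro mult_left_mono) auto
      moreover have "0 \<le> x n z 0 * (sig - 1) / X n z * (dev n z 0)\<^sup>2" using x_bounds[OF z] X sig by (intro mult_nonneg_nonneg divide_nonneg_nonneg) auto
      ultimately show ?thesis using True by simp
    next
      case False
      then have "del / 2 \<le> x n z 0" using m_pos[of n] by (simp add: field_simps)
      then have "del / 2 * (sig - 1) \<le> x n z 0 * (sig - 1)" using sig by (intro mult_right_mono) auto
      then have "c \<le> x n z 0 * (sig - 1) / X n z"
        unfolding c_def by (rule frac_le[rotated]) (use X sig x_bounds[OF z] in auto)
      then have "c * (dev n z 0)\<^sup>2 \<le> x n z 0 * (sig - 1) / X n z * (dev n z 0)\<^sup>2" by (intro mult_right_mono) auto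
      then show ?thesis using False by simp
    qed
    then show ?thesis unfolding eq using rem by linarith
  qed
  have le: "\<forall>\<^sub>F n in sequentially. ex n (\<lambda>z. (dev n z 0)\<^sup>2) \<le> (e n + (c * B\<^sup>2) * ?p n + B * (sig * err n)) / c"
    using e(2)
  proof eventually_elim
    case (elim n)
    have "c * ex n (\<lambda>z. (dev n z 0)\<^sup>2)
       \<le> ex n (\<lambda>z. dev n z 0 * (x n z 0 - ratio n z 0) + (c * B\<^sup>2) * ?i n z + B * (sig * err n))"
      unfolding ex_cmult[symmetric] by (rule ex_mono[OF pt])
    also have "\<dots> = ex n (\<lambda>z. dev n z 0 * (x n z 0 - ratio n z 0)) + (c * B\<^sup>2) * ?p n + B * (sig * err n)"
      by (simp only: ex_add ex_cmult[of n "c * B\<^sup>2"] ex_const)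
    finally show ?case using elim c by (simp add: le_divide_eq mult.commute)
  qed
  have "(\<lambda>n. (e n + (c * B\<^sup>2) * ?p n + B * (sig * err n)) / c) \<longlonglongrightarrow> (0 + (c * B\<^sup>2) * 0 + B * (sig * 0)) / c"
    by (intro tendsto_intros e err_tendsto tendsto_zero_of_m_times[OF lim]) (use c in auto)
  then have lim: "(\<lambda>n. (e n + (c * B\<^sup>2) * ?p n + B * (sig * err n)) / c) \<longlonglongrightarrow> 0" by simp
  show ?thesis by (rule tendsto_zero_squeeze[OF _ le lim]) (auto intro!: ex_nonneg)
qed

lemma rho_fixpoint:
  assumes "1 \<le> k" "k \<le> K"
  shows "sig * exp (- a) * rho k = sig * rho 0 * Nlim 0 k + (\<Sum>i\<in>{1..K}. rho i * Nlim i k)"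
proof -
  have Nl: "Nlim i k = exp (- a) * (a ^ (k - i) / fact (k - i))" if "i \<le> k" for i
    using that assms by (simp add: Nlim_def poisson_mutation_def)
  have "(\<Sum>i\<in>{1..K}. rho i * Nlim i k) = (\<Sum>i\<in>{1..k}. rho i * Nlim i k)"
    using assms by (intro sum.mono_neutral_right) (auto simp: Nlim_def poisson_mutation_def)
  also have "\<dots> = (\<Sum>i\<in>{1..k}. exp (- a) * (rho i * a ^ (k - i) / fact (k - i)))"
    by (intro sum.cong) (auto simp: Nl)
  also have "\<dots> = exp (- a) * (\<Sum>i\<in>{1..k}. rho i * a ^ (k - i) / fact (k - i))" by (simp add: sum_distrib_left)
  finally have 1: "(\<Sum>i\<in>{1..K}. rho i * Nlim i k) = exp (- a) * (\<Sum>i\<in>{1..k}. rho i * a ^ (k - i) / fact (k - i))" .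
  have "sig * rho k = (sig - 1) * rho 0 * a ^ k / fact k + (rho 0 * a ^ k / fact k + (\<Sum>i\<in>{1..k}. rho i * a ^ (k - i) / fact (k - i)))"
    unfolding rho_star_recursion[OF sig, of a k] by (simp add: atMost_atLeast0 sum.atLeast_Suc_atMost)
  then have "exp (- a) * (sig * rho k) = exp (- a) * (sig * rho 0 * (a ^ k / fact k) + (\<Sum>i\<in>{1..k}. rho i * a ^ (k - i) / fact (k - i)))"
    by (simp add: algebra_simps diff_divide_distrib)
  then show ?thesis unfolding 1 Nl[OF le0] by (simp add: algebra_simps)
qed

lemma second_moment_step:
  assumes k: "1 \<le> k" "k \<le> K" and IH: "\<And>j. j < k \<Longrightarrow> (\<lambda>n. ex n (\<lambda>z. (dev n z j)\<^sup>2)) \<longlonglongrightarrow> 0"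
  shows "(\<lambda>n. ex n (\<lambda>z. (dev n z k)\<^sup>2)) \<longlonglongrightarrow> 0"
proof -
  obtain e where e: "e \<longlonglongrightarrow> 0"
    "\<forall>\<^sub>F n in sequentially. ex n (\<lambda>z. dev n z k * (x n z k - ratio n z k)) \<le> e n"
    by (rule energy_tendsto[of k "rho k"]) (use k in auto)
  define c where "c = 1 - exp (- a)"
  have c: "0 < c" using a_pos by (simp add: c_def)
  define C where "C = (sig - 1) * \<bar>rho k\<bar> + sig"
  have C: "0 \<le> C" using sig by (simp add: C_def)
  define S where "S n z = (\<Sum>j<k. \<bar>dev n z j\<bar>)" for n z
  have pt: "(c / 2) * (dev n z k)\<^sup>2 \<le> dev n z k * (x n z k - ratio n z k)
     + (C\<^sup>2 * real k / c) * (\<Sum>j<k. (dev n z j)\<^sup>2) + (sig * err n)\<^sup>2 / c"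
    if z: "z \<in> EK K (m n)" for n z
  proof -
    obtain d where d: "ratio n z k = (w n z k + d) / X n z" "\<bar>d\<bar> \<le> sig * err n"
      using ratio_approx[OF z k(2)] by auto
    have X: "1 \<le> X n z" "X n z \<le> sig" using X_bounds[OF z] .
    define T where "T = (sig - 1) * dev n z 0 * rho k - sig * dev n z 0 * Nlim 0 k - (\<Sum>j\<in>{1..<k}. dev n z j * Nlim j k) - d"
    have rest: "(\<Sum>i\<in>{1..K}. dev n z i * Nlim i k) = (\<Sum>j\<in>{1..<k}. dev n z j * Nlim j k) + exp (- a) * dev n z k"
    proof -
      have "(\<Sum>i\<in>{1..K}. dev n z i * Nlim i k) = (\<Sum>i\<in>insert k {1..<k}. dev n z i * Nlim i k)"
        using k by (intro sum.mono_neutral_right) (auto simp: Nlim_def poisson_mutation_def)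
      moreover have "Nlim k k = exp (- a)" using k by (simp add: Nlim_def poisson_mutation_def)
      ultimately show ?thesis by simp
    qed
    have "w n z k - sig * exp (- a) * rho k = sig * dev n z 0 * Nlim 0 k + (\<Sum>i\<in>{1..K}. dev n z i * Nlim i k)"
      unfolding rho_fixpoint[OF k] w_def by (simp add: left_diff_distrib right_diff_distrib sum_subtractf)
    moreover have "X n z - sig * exp (- a) = (sig - 1) * dev n z 0"
    proof -
      have "(sig - 1) * rho 0 = sig * exp (- a) - 1" using sig by (simp add: rho_star_zero)
      then show ?thesis by (simp only: X_def right_diff_distrib)
    qed
    ultimately have num: "X n z * x n z k - w n z k - d = (X n z - exp (- a)) * dev n z k + T"
      unfolding rest T_def by algebra
    have "x n z k - ratio n z k = (X n z * x n z k - w n z k - d) / X n z" using X unfolding d(1) by (simp add: field_simps)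
    have eq: "dev n z k * (x n z k - ratio n z k) = (X n z - exp (- a)) / X n z * (dev n z k)\<^sup>2 + dev n z k * T / X n z"
    proof -
      have "v * ((y * v + T) / X n z) = y / X n z * v\<^sup>2 + v * T / X n z" for v y
        by (simp add: power2_eq_square add_divide_distrib distrib_left mult_ac)
      then show ?thesis unfolding \<open>x n z k - ratio n z k = _\<close> num .
    qed
    have "exp (- a) / X n z \<le> exp (- a)" using divide_X_le[OF z, of "exp (- a)"] X by simp
    then have "c \<le> (X n z - exp (- a)) / X n z" using X by (simp add: c_def diff_divide_distrib)
    then have main: "c * (dev n z k)\<^sup>2 \<le> (X n z - exp (- a)) / X n z * (dev n z k)\<^sup>2" by (intro mult_right_mono) auto
    have young: "2 * (c * (\<bar>dev n z k\<bar> * \<bar>T\<bar>)) \<le> c\<^sup>2 * (dev n z k)\<^sup>2 + T\<^sup>2"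
      using zero_le_power2[of "c * \<bar>dev n z k\<bar> - \<bar>T\<bar>"] by (simp add: power2_diff power_mult_distrib mult_ac)
    have "- (dev n z k * T / X n z) \<le> \<bar>dev n z k\<bar> * \<bar>T\<bar>"
    proof -
      have "\<bar>dev n z k * T / X n z\<bar> \<le> \<bar>dev n z k * T\<bar>" by (rule divide_X_le[OF z])
      then show ?thesis unfolding abs_mult by linarith
    qed
    also have "\<dots> \<le> c / 2 * (dev n z k)\<^sup>2 + T\<^sup>2 / (2 * c)"
      using young c by (simp add: field_simps power2_eq_square)
    finally have cross: "- (dev n z k * T / X n z) \<le> c / 2 * (dev n z k)\<^sup>2 + T\<^sup>2 / (2 * c)" .
    have "\<bar>T\<bar> \<le> C * S n z + sig * err n"
    proof -
      have "\<bar>(sig - 1) * dev n z 0 * rho k\<bar> \<le> (sig - 1) * \<bar>rho k\<bar> * \<bar>dev n z 0\<bar>" using sig by (simp add: abs_mult)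
      also have "\<dots> \<le> (sig - 1) * \<bar>rho k\<bar> * S n z"
        unfolding S_def using sig k by (intro mult_left_mono member_le_sum) auto
      finally have 1: "\<bar>(sig - 1) * dev n z 0 * rho k\<bar> \<le> (sig - 1) * \<bar>rho k\<bar> * S n z" .
      have "\<bar>sig * dev n z 0 * Nlim 0 k\<bar> \<le> sig * \<bar>dev n z 0\<bar>"
        using sig Nlim_bounds[of 0 k] by (simp add: abs_mult mult_left_le)
      moreover have "\<bar>\<Sum>j\<in>{1..<k}. dev n z j * Nlim j k\<bar> \<le> (\<Sum>j\<in>{1..<k}. sig * \<bar>dev n z j\<bar>)"
      proof (intro order_trans[OF sum_abs] sum_mono)
        fix j
        have "\<bar>dev n z j\<bar> * Nlim j k \<le> \<bar>dev n z j\<bar> * sig"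
          using sig Nlim_bounds[of j k] by (intro mult_left_mono) auto
        then show "\<bar>dev n z j * Nlim j k\<bar> \<le> sig * \<bar>dev n z j\<bar>"
          using Nlim_bounds[of j k] by (simp add: abs_mult mult.commute)
      qed
      moreover have "sig * S n z = sig * \<bar>dev n z 0\<bar> + (\<Sum>j\<in>{1..<k}. sig * \<bar>dev n z j\<bar>)"
        unfolding S_def using k by (simp add: lessThan_atLeast0 sum.atLeast_Suc_lessThan sum_distrib_left distrib_left)
      ultimately show ?thesis using 1 d(2) unfolding T_def C_def distrib_right by linarith
    qed
    then have "T\<^sup>2 \<le> (C * S n z + sig * err n)\<^sup>2"
      by (simp add: abs_le_square_iff[symmetric])
    also have "\<dots> \<le> 2 * (C * S n z)\<^sup>2 + 2 * (sig * err n)\<^sup>2"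
      using zero_le_power2[of "C * S n z - sig * err n"] by (simp add: power2_sum power2_diff)
    also have "(S n z)\<^sup>2 \<le> (\<Sum>j<k. (dev n z j)\<^sup>2) * real k"
      unfolding S_def using sum_squared_le_sum_of_squares[of "\<lambda>j. \<bar>dev n z j\<bar>" "{..<k}"] by simp
    then have "2 * (C * S n z)\<^sup>2 \<le> 2 * (C\<^sup>2 * ((\<Sum>j<k. (dev n z j)\<^sup>2) * real k))"
      unfolding power_mult_distrib by (intro mult_left_mono) auto
    finally have "T\<^sup>2 / (2 * c) \<le> (2 * (C\<^sup>2 * ((\<Sum>j<k. (dev n z j)\<^sup>2) * real k)) + 2 * (sig * err n)\<^sup>2) / (2 * c)"
      using c by (intro divide_right_mono) auto
    also have "\<dots> = (C\<^sup>2 * real k / c) * (\<Sum>j<k. (dev n z j)\<^sup>2) + (sig * err n)\<^sup>2 / c"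
      using c by (simp add: field_simps)
    finally show ?thesis unfolding eq using main cross by linarith
  qed
  let ?F = "\<lambda>n. (e n + (C\<^sup>2 * real k / c) * (\<Sum>j<k. ex n (\<lambda>z. (dev n z j)\<^sup>2)) + (sig * err n)\<^sup>2 / c) / (c / 2)"
  have le: "\<forall>\<^sub>F n in sequentially. ex n (\<lambda>z. (dev n z k)\<^sup>2) \<le> ?F n"
    using e(2)
  proof eventually_elim
    case (elim n)
    have "(c / 2) * ex n (\<lambda>z. (dev n z k)\<^sup>2) \<le> ex n (\<lambda>z. dev n z k * (x n z k - ratio n z k)
     + (C\<^sup>2 * real k / c) * (\<Sum>j<k. (dev n z j)\<^sup>2) + (sig * err n)\<^sup>2 / c)"
      unfolding ex_cmult[symmetric] by (rule ex_mono[OF pt])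
    also have "\<dots> = ex n (\<lambda>z. dev n z k * (x n z k - ratio n z k))
     + (C\<^sup>2 * real k / c) * (\<Sum>j<k. ex n (\<lambda>z. (dev n z j)\<^sup>2)) + (sig * err n)\<^sup>2 / c"
      by (simp only: ex_add ex_cmult[of n "C\<^sup>2 * real k / c"] ex_const ex_sum)
    finally have "(c / 2) * ex n (\<lambda>z. (dev n z k)\<^sup>2) \<le> e n + (C\<^sup>2 * real k / c) * (\<Sum>j<k. ex n (\<lambda>z. (dev n z j)\<^sup>2)) + (sig * err n)\<^sup>2 / c"
      using elim by linarith
    then show ?case using c by (subst pos_le_divide_eq) (auto simp: mult.commute)
  qed
  have "?F \<longlonglongrightarrow> (0 + (C\<^sup>2 * real k / c) * (\<Sum>j<k. 0) + (sig * 0)\<^sup>2 / c) / (c / 2)"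
    by (intro tendsto_intros e err_tendsto IH) (use c in auto)
  then have lim: "?F \<longlonglongrightarrow> 0" by simp
  show ?thesis by (rule tendsto_zero_squeeze[OF _ le lim]) (auto intro!: ex_nonneg)
qed

lemma second_moment:
  assumes "k \<le> K" shows "(\<lambda>n. ex n (\<lambda>z. (dev n z k)\<^sup>2)) \<longlonglongrightarrow> 0"
  using assms
proof (induction k rule: less_induct)
  case (less k)
  show ?case
  proof (cases "k = 0")
    case True
    then show ?thesis using second_moment_zero by simp
  next
    case False
    show ?thesis by (rule second_moment_step) (use False less in auto)
  qed
qed

lemma total_second_moment:
  "(\<lambda>n. ex n (\<lambda>z. (real (ssum K z) / real (m n) - (\<Sum>k\<le>K. rho k))\<^sup>2)) \<longlonglongrightarrow> 0"
proof -
  have "(real (ssum K z) / real (m n) - (\<Sum>k\<le>K. rho k))\<^sup>2 \<le> (real K + 1) * (\<Sum>k\<le>K. (dev n z k)\<^sup>2)" for n z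
  proof -
    have "real (ssum K z) / real (m n) - (\<Sum>k\<le>K. rho k) = (\<Sum>k\<le>K. dev n z k)"
      by (simp add: ssum_def sum_divide_distrib sum_subtractf)
    then show ?thesis using sum_squared_le_sum_of_squares[of "dev n z" "{..K}"] by (simp add: mult.commute add.commute)
  qed
  then have le: "\<forall>\<^sub>F n in sequentially. ex n (\<lambda>z. (real (ssum K z) / real (m n) - (\<Sum>k\<le>K. rho k))\<^sup>2)
      \<le> (real K + 1) * (\<Sum>k\<le>K. ex n (\<lambda>z. (dev n z k)\<^sup>2))"
    unfolding ex_sum[symmetric] ex_cmult[symmetric] by (intro always_eventually allI ex_mono)
  have "(\<lambda>n. (real K + 1) * (\<Sum>k\<le>K. ex n (\<lambda>z. (dev n z k)\<^sup>2))) \<longlonglongrightarrow> (real K + 1) * (\<Sum>k\<le>K. 0)"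
    by (intro tendsto_intros second_moment) auto
  then have lim: "(\<lambda>n. (real K + 1) * (\<Sum>k\<le>K. ex n (\<lambda>z. (dev n z k)\<^sup>2))) \<longlonglongrightarrow> 0" by simp
  show ?thesis by (rule tendsto_zero_squeeze[OF _ le lim]) (auto intro!: ex_nonneg)
qed

lemma total_in_unit_interval: "z \<in> EK K (m n) \<Longrightarrow> real (ssum K z) / real (m n) \<in> {0..1}"
  using m_pos[of n] by (auto simp: EK_iff)

lemma rho_total_in_unit_interval: "(\<Sum>k\<le>K. rho k) \<in> {0..1}"
proof (rule ccontr)
  let ?R = "\<Sum>k\<le>K. rho k"
  assume R: "?R \<notin> {0..1}"
  define g where "g = (if ?R < 0 then - ?R else ?R - 1)"
  have g: "0 < g" using R by (auto simp: g_def)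
  have "g\<^sup>2 \<le> ex n (\<lambda>z. (real (ssum K z) / real (m n) - ?R)\<^sup>2)" for n
  proof -
    have "ex n (\<lambda>z. g\<^sup>2) \<le> ex n (\<lambda>z. (real (ssum K z) / real (m n) - ?R)\<^sup>2)"
    proof (rule ex_mono)
      fix z assume "z \<in> EK K (m n)"
      then have "real (ssum K z) / real (m n) \<in> {0..1}" by (rule total_in_unit_interval)
      moreover have "\<bar>g\<bar> \<le> \<bar>y - ?R\<bar>" if "y \<in> {0..1}" for y using g that by (auto simp: g_def split: if_splits)
      ultimately have "\<bar>g\<bar> \<le> \<bar>real (ssum K z) / real (m n) - ?R\<bar>" by blast
      then show "g\<^sup>2 \<le> (real (ssum K z) / real (m n) - ?R)\<^sup>2" by (simp add: abs_le_square_iff)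
    qed
    then show ?thesis by (simp add: ex_const)
  qed
  then have "g\<^sup>2 \<le> 0" using LIMSEQ_le_const[OF total_second_moment] by blast
  then show False using g by simp
qed

lemma ex_continuous_tendsto:
  fixes f :: "real \<Rightarrow> real"
  assumes f: "continuous_on {0..1} f"
  shows "(\<lambda>n. ex n (\<lambda>z. f (real (ssum K z) / real (m n)))) \<longlonglongrightarrow> f (\<Sum>k\<le>K. rho k)"
proof (rule LIMSEQ_I)
  fix eps :: real assume eps: "0 < eps"
  let ?R = "\<Sum>k\<le>K. rho k" and ?s = "\<lambda>n z. real (ssum K z) / real (m n)"
  have "bounded (f ` {0..1})" using compact_continuous_image[OF f] compact_imp_bounded by blast
  then obtain B where B: "0 < B" "\<And>y. y \<in> {0..1} \<Longrightarrow> \<bar>f y\<bar> \<le> B" by (auto simp: bounded_pos)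
  obtain d where d: "0 < d" "\<And>y. y \<in> {0..1} \<Longrightarrow> \<bar>y - ?R\<bar> < d \<Longrightarrow> \<bar>f y - f ?R\<bar> < eps / 2"
    using f[unfolded continuous_on_iff, rule_format, OF rho_total_in_unit_interval, of "eps / 2"] eps
    by (auto simp: dist_real_def)
  have pt: "\<bar>f y - f ?R\<bar> \<le> eps / 2 + 2 * B / d\<^sup>2 * (y - ?R)\<^sup>2" if y: "y \<in> {0..1}" for y
  proof (cases "\<bar>y - ?R\<bar> < d")
    case True
    then show ?thesis using d(2)[OF y] B(1) by (intro add_increasing2) auto
  next
    case False
    then have "d\<^sup>2 \<le> (y - ?R)\<^sup>2" using d(1) by (simp add: abs_le_square_iff[symmetric])
    then have "2 * B * 1 \<le> 2 * B * ((y - ?R)\<^sup>2 / d\<^sup>2)" using B(1) d(1) by (intro mult_left_mono) auto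
    moreover have "\<bar>f y - f ?R\<bar> \<le> 2 * B" using B(2)[OF y] B(2)[OF rho_total_in_unit_interval] by linarith
    ultimately show ?thesis using eps by simp
  qed
  have bound: "\<bar>ex n (\<lambda>z. f (?s n z)) - f ?R\<bar> \<le> eps / 2 + 2 * B / d\<^sup>2 * ex n (\<lambda>z. (?s n z - ?R)\<^sup>2)" for n
  proof -
    have "ex n (\<lambda>z. f (?s n z)) \<le> ex n (\<lambda>z. f ?R + (eps / 2 + 2 * B / d\<^sup>2 * (?s n z - ?R)\<^sup>2))"
      using pt[OF total_in_unit_interval] by (intro ex_mono) (fastforce simp: abs_le_iff)
    moreover have "ex n (\<lambda>z. f ?R) \<le> ex n (\<lambda>z. f (?s n z) + (eps / 2 + 2 * B / d\<^sup>2 * (?s n z - ?R)\<^sup>2))"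
      using pt[OF total_in_unit_interval] by (intro ex_mono) (fastforce simp: abs_le_iff)
    ultimately show ?thesis by (simp only: ex_add ex_const ex_cmult)
  qed
  have "(\<lambda>n. 2 * B / d\<^sup>2 * ex n (\<lambda>z. (?s n z - ?R)\<^sup>2)) \<longlonglongrightarrow> 2 * B / d\<^sup>2 * 0"
    by (intro tendsto_intros total_second_moment)
  then have "\<forall>\<^sub>F n in sequentially. 2 * B / d\<^sup>2 * ex n (\<lambda>z. (?s n z - ?R)\<^sup>2) < eps / 2"
    unfolding mult_zero_right by (rule order_tendstoD(2)) (use eps in simp)
  then obtain n0 where n0: "\<And>n. n \<ge> n0 \<Longrightarrow> 2 * B / d\<^sup>2 * ex n (\<lambda>z. (?s n z - ?R)\<^sup>2) < eps / 2"
    by (auto simp: eventually_sequentially)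
  show "\<exists>n0. \<forall>n\<ge>n0. norm (ex n (\<lambda>z. f (?s n z)) - f ?R) < eps"
    using n0 bound by (intro exI[of _ n0]) (smt (verit) field_sum_of_halves real_norm_def)
qed

end

theorem mainTheorem8:
  fixes kap K :: nat and sig a :: real and \<alpha> :: ereal
    and l m :: "nat \<Rightarrow> nat" and q :: "nat \<Rightarrow> real"
    and upper :: bool
    and \<nu> :: "nat \<Rightarrow> (nat \<Rightarrow> nat) \<Rightarrow> real"
    and f :: "real \<Rightarrow> real"
  assumes kap: "kap \<ge> 2" and sig: "sig > 1"
    and l_ge: "\<And>n. l n \<ge> K + 2" and m_ge: "\<And>n. m n \<ge> 2"
    and q_pos: "\<And>n. 0 < q n" and q_lt: "\<And>n. q n < 1 - 1 / real kap"
    and l_lim: "filterlim l at_top sequentially"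
    and m_lim: "filterlim m at_top sequentially"
    and q_lim: "q \<longlonglongrightarrow> 0"
    and a_pos: "0 < a"
    and lq_lim: "(\<lambda>n. real (l n) * q n) \<longlonglongrightarrow> a"
    and ml_lim: "(\<lambda>n. ereal (real (m n) / real (l n))) \<longlonglongrightarrow> \<alpha>"
    and sig_a: "sig * exp (- a) > 1"
    and inv: "\<And>n. invariant_prob (EK K (m n))
                 (pth kap sig K (l n) (m n) (q n) (if upper then l n else K + 1)) (\<nu> n)"
    and f_cont: "continuous_on {0..1} f" and f_mono: "mono_on {0..1} f" and f0: "f 0 = 0"
  shows "(\<lambda>n. \<Sum>z\<in>EK K (m n). f (real (ssum K z) / real (m n)) * \<nu> n z)
           \<longlonglongrightarrow> f (\<Sum>k\<le>K. rho_star sig a k)"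
proof -
  interpret mutation_regime kap K sig a l m q upper \<nu>
    using kap sig l_ge m_ge q_pos q_lt l_lim m_lim q_lim a_pos lq_lim sig_a inv by unfold_locales
  show ?thesis
    using ex_continuous_tendsto[OF f_cont] by (simp add: ex_def mult.commute)
qed

end
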